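(* Let $p$ be a prime, let $\zeta_p$ be a fixed primitive $p$th root of unity in an algebraic closure of $\mathbb{Q}_p$, and let $\pi=-\sum_{k=1}^{p-1}\frac{(1-\zeta_p)^k}{k}\in\mathbb{Z}_p[\zeta_p]$. (i) $\pi^{p-1}\equiv-p\pmod{p^2}$, i.e. $\pi^{p-1}/p\equiv-1\pmod p$. (ii) Let $a\in\mathbb{Z}$ and $n\in\mathbb{N}$. If $m\in\mathbb{N}$ and $m\equiv-n\pmod p$, then $$(\zeta_p^a-1)^n\equiv\sum_{j=0}^{p-2}B^{(m)}_j\frac{(a\pi)^{n+j}}{j!}\pmod{p\pi^n}.$$ Moreover, for each positive integer $b$, $$(\zeta_p^a-1)^{p^bn}\equiv(a\pi)^{p^bn}+p^bn\sum_{1<k<p-1}\frac{B_k}{k!\,k}(a\pi)^{p^bn+k}\pmod{p^{b+1}\pi^{p^bn}}.$$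
   Context: For $m\in\mathbb{N}$ the $m$th order Bernoulli numbers $B^{(m)}_k$ are defined by $\left(\frac{x}{e^x-1}\right)^m=\sum_{k\ge0}B^{(m)}_k\frac{x^k}{k!}$, and $B_k=B^{(1)}_k$. For elements $\alpha,\beta,\gamma$ ($\gamma\ne0$) of $\mathbb{Q}_p(\zeta_p)$, $\alpha\equiv\beta\pmod\gamma$ means $(\alpha-\beta)/\gamma\in\mathbb{Z}_p[\zeta_p]$. *)

theory Defs
  imports
    "HOL-Algebra.Algebraic_Closure_Type"
    "HOL-Computational_Algebra.Computational_Algebra"
    "HOL-Library.Cardinality"
begin

section \<open>The \<open>p\<close>-adic integers and numbers\<close>

text \<open>
  The prime \<open>p\<close> is \<open>CARD('p)\<close> for a type \<open>'p\<close> of prime cardinality. The ring \<open>\<int>\<^sub>p\<close> is the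
  projective limit of the rings \<open>\<int>/p\<^sup>n\<close>: an element is a sequence of residues with
  \<open>f n \<in> {0..<p\<^sup>n}\<close>, where the range condition is implied by the compatibility condition.
\<close>

class prime_card =
  assumes prime_card: "prime CARD('a)"

typedef (overloaded) ('p :: prime_card) padic_int =
  "{f :: nat \<Rightarrow> int. \<forall>n. f (Suc n) mod int CARD('p) ^ n = f n}"
  by (rule exI[of _ "\<lambda>_. 0"]) simp

setup_lifting type_definition_padic_int

lemma padic_mod_Suc:
  fixes q x :: int
  shows "x mod q ^ Suc n mod q ^ n = x mod q ^ n"
  by (simp add: mod_mod_cancel)

instantiation padic_int :: (prime_card) comm_ring_1
begin

lift_definition zero_padic_int :: "'a padic_int" is "\<lambda>_. 0" by simp

lift_definition one_padic_int :: "'a padic_int" is "\<lambda>n. 1 mod int CARD('a) ^ n"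
  by (simp only: padic_mod_Suc simp_thms)

lift_definition plus_padic_int :: "'a padic_int \<Rightarrow> 'a padic_int \<Rightarrow> 'a padic_int"
  is "\<lambda>f g n. (f n + g n) mod int CARD('a) ^ n"
  by (simp only: padic_mod_Suc) (metis mod_add_eq)

lift_definition minus_padic_int :: "'a padic_int \<Rightarrow> 'a padic_int \<Rightarrow> 'a padic_int"
  is "\<lambda>f g n. (f n - g n) mod int CARD('a) ^ n"
  by (simp only: padic_mod_Suc) (metis mod_diff_eq)

lift_definition uminus_padic_int :: "'a padic_int \<Rightarrow> 'a padic_int"
  is "\<lambda>f n. (- f n) mod int CARD('a) ^ n"
  by (simp only: padic_mod_Suc) (metis mod_minus_eq)

lift_definition times_padic_int :: "'a padic_int \<Rightarrow> 'a padic_int \<Rightarrow> 'a padic_int"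
  is "\<lambda>f g n. (f n * g n) mod int CARD('a) ^ n"
  by (simp only: padic_mod_Suc) (metis mod_mult_eq)

instance
proof
  fix x y z :: "'a padic_int"
  show "x * y * z = x * (y * z)"
    by transfer (simp add: fun_eq_iff mod_mult_left_eq mod_mult_right_eq mult.assoc)
  show "x * y = y * x" by transfer (simp add: mult.commute)
  show "1 * x = x"
    by transfer (simp add: fun_eq_iff mod_mult_left_eq, metis mod_mod_trivial)
  show "x + y + z = x + (y + z)"
    by transfer (simp add: fun_eq_iff mod_add_left_eq mod_add_right_eq add.assoc)
  show "x + y = y + x" by transfer (simp add: add.commute)
  show "0 + x = x" by transfer (simp add: fun_eq_iff, metis mod_mod_trivial)
  show "- x + x = 0" by transfer (simp add: fun_eq_iff mod_add_left_eq)
  show "x - y = x + - y" by transfer (simp add: fun_eq_iff mod_add_right_eq)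
  show "(x + y) * z = x * z + y * z"
    by transfer (simp add: fun_eq_iff mod_mult_left_eq mod_add_eq distrib_right)
  show "(0 :: 'a padic_int) \<noteq> 1"
  proof transfer
    have "(1 :: int) mod int CARD('a) ^ 1 \<noteq> 0"
      using prime_gt_1_nat[OF prime_card[where 'a='a]] by simp
    then show "(\<lambda>_. 0) \<noteq> (\<lambda>n. 1 mod int CARD('a) ^ n)" by (metis)
  qed
qed

end

lemma padic_int_residue_mod:
  fixes x :: "'p :: prime_card padic_int"
  assumes "n \<le> k"
  shows "Rep_padic_int x k mod int CARD('p) ^ n = Rep_padic_int x n"
  using assms
proof (induction k rule: dec_induct)
  case base
  show ?case using Rep_padic_int[of x] by simp (metis mod_mod_trivial)
next
  case (step k)
  have "Rep_padic_int x (Suc k) mod int CARD('p) ^ n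
      = Rep_padic_int x (Suc k) mod int CARD('p) ^ k mod int CARD('p) ^ n"
    using step.hyps by (simp add: mod_mod_cancel le_imp_power_dvd)
  also have "Rep_padic_int x (Suc k) mod int CARD('p) ^ k = Rep_padic_int x k"
    using Rep_padic_int[of x] by simp
  finally show ?case using step.IH by simp
qed

instance padic_int :: (prime_card) idom
proof
  fix x y :: "'a padic_int"
  let ?p = "int CARD('a)"
  have p: "prime ?p" using prime_card[where 'a='a] by simp
  assume "x \<noteq> 0" "y \<noteq> 0"
  then obtain n m where n: "Rep_padic_int x n \<noteq> 0" and m: "Rep_padic_int y m \<noteq> 0"
    by (metis Rep_padic_int_inject zero_padic_int.rep_eq ext)
  let ?X = "Rep_padic_int x (n + m)" and ?Y = "Rep_padic_int y (n + m)"
  have X: "\<not> ?p ^ n dvd ?X"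
    using padic_int_residue_mod[of n "n + m" x] n by (simp add: dvd_eq_mod_eq_0)
  have Y: "\<not> ?p ^ m dvd ?Y"
    using padic_int_residue_mod[of m "n + m" y] m by (simp add: dvd_eq_mod_eq_0)
  have "?X \<noteq> 0" "?Y \<noteq> 0" using X Y by auto
  moreover have "multiplicity ?p ?X < n" "multiplicity ?p ?Y < m"
    using X Y by (meson multiplicity_dvd' not_le)+
  ultimately have "multiplicity ?p (?X * ?Y) < n + m"
    using p by (simp add: prime_elem_multiplicity_mult_distrib)
  then have "\<not> ?p ^ (n + m) dvd ?X * ?Y"
    using \<open>?X \<noteq> 0\<close> \<open>?Y \<noteq> 0\<close> p
    by (metis mult_eq_0_iff not_le not_prime_unit power_dvd_iff_le_multiplicity)
  then have "Rep_padic_int (x * y) (n + m) \<noteq> 0"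
    by (simp add: times_padic_int.rep_eq dvd_eq_mod_eq_0)
  then show "x * y \<noteq> 0" by (metis zero_padic_int.rep_eq)
qed

lemma Rep_padic_int_of_nat:
  "Rep_padic_int (of_nat k :: 'p :: prime_card padic_int) n = int k mod int CARD('p) ^ n"
  by (induction k)
    (simp_all add: zero_padic_int.rep_eq one_padic_int.rep_eq plus_padic_int.rep_eq mod_add_eq)

instance padic_int :: (prime_card) ring_char_0
proof
  show "inj (of_nat :: nat \<Rightarrow> 'a padic_int)"
  proof (rule injI)
    fix k l assume eq: "(of_nat k :: 'a padic_int) = of_nat l"
    have p: "CARD('a) > 1" using prime_gt_1_nat[OF prime_card[where 'a='a]] .
    define n where "n = k + l"
    have "n < CARD('a) ^ n" using p by (simp add: power_gt_expt)
    then have "k < CARD('a) ^ n" "l < CARD('a) ^ n" by (simp_all add: n_def)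
    moreover have "int k mod int CARD('a) ^ n = int l mod int CARD('a) ^ n"
      using eq by (metis Rep_padic_int_of_nat)
    then have "k mod CARD('a) ^ n = l mod CARD('a) ^ n"
      by (metis of_nat_power of_nat_mod of_nat_eq_iff)
    ultimately show "k = l" by simp
  qed
qed

instance fract :: ("{idom, ring_char_0}") field_char_0
proof
  have "of_nat k = Fract (of_nat k) (1 :: 'a)" for k
    by (induction k) (simp_all add: Zero_fract_def One_fract_def)
  then show "inj (of_nat :: nat \<Rightarrow> 'a fract)"
    by (auto intro!: injI simp: eq_fract)
qed

type_synonym 'p padic = "'p padic_int fract"


section \<open>Congruences over the ring \<open>\<int>\<^sub>p[\<zeta>]\<close>\<close>

definition padic_int_to_ac :: "'p :: prime_card padic_int \<Rightarrow> 'p padic alg_closure" where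
  "padic_int_to_ac x = to_ac (Fract x 1)"

definition padic_int_adjoin :: "'p :: prime_card padic alg_closure \<Rightarrow> 'p padic alg_closure set" where
  "padic_int_adjoin \<zeta> = range (\<lambda>f. poly (map_poly padic_int_to_ac f) \<zeta>)"

text \<open>
  The congruence \<open>\<alpha> \<equiv> \<beta> (mod \<gamma>)\<close>, meant for \<open>\<alpha>\<close>, \<open>\<beta>\<close>, \<open>\<gamma>\<close> in the field \<open>\<rat>\<^sub>p(\<zeta>)\<close>. The quotient
  does not depend on the field in which it is formed, so it is taken in the algebraic closure.
  The condition \<open>\<gamma> \<noteq> 0\<close> is part of the definition, since \<open>x / 0 = 0\<close> would otherwise make
  every congruence modulo zero true.
\<close>

definition padic_cong ::
  "'p :: prime_card padic alg_closure \<Rightarrow> 'p padic alg_closure \<Rightarrow> 'p padic alg_closure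
     \<Rightarrow> 'p padic alg_closure \<Rightarrow> bool" where
  "padic_cong \<zeta> \<alpha> \<beta> \<gamma> \<longleftrightarrow> \<gamma> \<noteq> 0 \<and> (\<alpha> - \<beta>) / \<gamma> \<in> padic_int_adjoin \<zeta>"

definition primitive_root_of_unity :: "nat \<Rightarrow> 'a :: field \<Rightarrow> bool" where
  "primitive_root_of_unity n \<zeta> \<longleftrightarrow> n > 0 \<and> \<zeta> ^ n = 1 \<and> (\<forall>k. 0 < k \<and> k < n \<longrightarrow> \<zeta> ^ k \<noteq> 1)"


section \<open>Bernoulli numbers of higher order\<close>

definition bernoulli_order :: "nat \<Rightarrow> nat \<Rightarrow> rat" where
  "bernoulli_order m k = fact k * fps_nth ((fps_X / (fps_exp 1 - 1)) ^ m) k"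

abbreviation bernoulli :: "nat \<Rightarrow> rat" where
  "bernoulli \<equiv> bernoulli_order 1"

text \<open>Division of power series over a field cancels the common factor \<open>X\<close>.\<close>

lemma bernoulli_fps_mult:
  "fps_X / (fps_exp 1 - 1) * (fps_exp 1 - 1) = (fps_X :: rat fps)"
proof -
  have nz: "fps_exp 1 - 1 \<noteq> (0 :: rat fps)"
    by (auto simp: fps_eq_iff intro!: exI[of _ 1])
  have "subdegree (fps_exp 1 - 1 :: rat fps) = 1"
    by (rule subdegreeI) auto
  then have "(fps_exp 1 - 1 :: rat fps) dvd fps_X"
    using nz by (subst fps_dvd_iff) auto
  then show ?thesis by simp
qed

end

theory Submission
  imports Defs
begin

text \<open>
  Put \<open>T = \<zeta> - 1\<close>. For \<open>Y\<close> in \<open>R = \<int>\<^sub>p[\<zeta>]\<close> the binomial theorem gives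
  \<open>(1 + Y)\<^sup>p \<equiv> 1 + p l(Y) + Y\<^sup>p\<close> modulo \<open>p\<^sup>2 Y\<close>, where \<open>l\<close> is the series of
  \<open>ln (1 + Y)\<close> truncated below degree \<open>p\<close>. For \<open>Y = T\<close> the left-hand side is \<open>1\<close> and
  \<open>l(T) = \<pi>\<close>, so \<open>T\<^sup>p \<equiv> - p \<pi>\<close>; with \<open>\<pi> = T v\<close> and \<open>v\<^sup>p \<equiv> 1\<close> modulo \<open>p\<close>
  this is (i).

  The identity \<open>exp (ln (1 + X)) = 1 + X\<close>, read modulo \<open>X\<^sup>p\<close>, shows that the truncated
  exponential of \<open>x = a \<pi>\<close> is \<open>\<zeta>\<^sup>a\<close> modulo \<open>p \<pi>\<close>. Hence, if \<open>p\<close> does not divide \<open>a\<close>,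
  the quotient \<open>w = (\<zeta>\<^sup>a - 1) / x\<close> is congruent modulo \<open>p\<close> to the value at \<open>x\<close> of the
  truncation of \<open>g = (e\<^sup>X - 1) / X\<close>. Modulo \<open>p\<close> the value of \<open>g\<close> has trivial \<open>p\<close>-th power,
  so \<open>w\<^sup>n\<close> agrees with the value of \<open>g\<^bsup>-m\<^esup>\<close>. Finally the binomial congruence for
  \<open>Y = g(x) - 1\<close> gives \<open>w\<^sup>p\<close> modulo \<open>p\<^sup>2\<close> in terms of the coefficients of \<open>ln g\<close>, which are
  \<open>B\<^sub>k / (k! k)\<close>, and further \<open>p\<close>-th powers lift the precision.
\<close>

section \<open>Subrings in which every element congruent to 1 modulo p is invertible\<close>

text \<open>Abstracts what the proof uses of \<open>\<int>\<^sub>p[\<zeta>]\<close>. The last axiom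
  puts \<open>p\<close> into the Jacobson radical and takes the place of completeness and
  valuations.\<close>

locale p_subring =
  fixes R :: "'a :: field_char_0 set" and p :: nat
  assumes prime_p: "prime p"
    and one_mem [simp, intro]: "1 \<in> R"
    and diff_mem [intro]: "\<And>a b. a \<in> R \<Longrightarrow> b \<in> R \<Longrightarrow> a - b \<in> R"
    and mult_mem [intro]: "\<And>a b. a \<in> R \<Longrightarrow> b \<in> R \<Longrightarrow> a * b \<in> R"
    and one_plus_p_invertible: "\<And>c. c \<in> R \<Longrightarrow> \<exists>d\<in>R. (1 + of_nat p * c) * d = 1"
begin

lemma zero_mem [simp, intro]: "0 \<in> R"
  using diff_mem[OF one_mem one_mem] by simp

lemma uminus_mem [intro]: "a \<in> R \<Longrightarrow> - a \<in> R"
  using diff_mem[of 0 a] by simp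

lemma add_mem [intro]: "a \<in> R \<Longrightarrow> b \<in> R \<Longrightarrow> a + b \<in> R"
  using diff_mem[of a "- b"] by (auto simp: uminus_mem)

lemma power_mem [intro]: "a \<in> R \<Longrightarrow> a ^ n \<in> R"
  by (induction n) auto

lemma sum_mem [intro]: "(\<And>i. i \<in> A \<Longrightarrow> f i \<in> R) \<Longrightarrow> sum f A \<in> R"
  by (induction A rule: infinite_finite_induct) auto

lemma of_nat_mem [simp, intro]: "of_nat n \<in> R"
  by (induction n) auto

lemma of_int_mem [simp, intro]: "of_int n \<in> R"
  by (cases n) (auto simp del: of_nat_Suc)

lemma p_gt_1: "p > 1" and p_nz [simp]: "of_nat p \<noteq> (0 :: 'a)"
  using prime_gt_1_nat[OF prime_p] by auto

definition is_unit_in :: "'a \<Rightarrow> bool" where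
  "is_unit_in a \<longleftrightarrow> a \<in> R \<and> a \<noteq> 0 \<and> inverse a \<in> R"

lemma is_unit_inI: "a \<in> R \<Longrightarrow> d \<in> R \<Longrightarrow> a * d = 1 \<Longrightarrow> is_unit_in a"
  unfolding is_unit_in_def by (metis inverse_unique mult_zero_left zero_neq_one)

lemma is_unit_inD: "is_unit_in a \<Longrightarrow> a \<in> R" "is_unit_in a \<Longrightarrow> a \<noteq> 0"
    "is_unit_in a \<Longrightarrow> inverse a \<in> R"
  by (auto simp: is_unit_in_def)

lemma is_unit_in_one_plus_p: "c \<in> R \<Longrightarrow> is_unit_in (1 + of_nat p * c)"
  using one_plus_p_invertible[of c] is_unit_inI[of "1 + of_nat p * c"] by auto

text \<open>Bezout yields \<open>v\<close> with \<open>k v = 1 - u p\<close>, and the right-hand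
  side is invertible by the axiom on \<open>1 + p c\<close>.\<close>

lemma is_unit_in_of_int:
  assumes "\<not> int p dvd k"
  shows "is_unit_in (of_int k)"
proof -
  have "coprime (int p) k"
    using assms prime_p by (intro prime_imp_coprime) auto
  then obtain u v where uv: "u * int p + v * k = 1"
    using bezout_int[of "int p" k] by auto
  have "of_int (v * k) = (of_int (1 + int p * (- u)) :: 'a)"
    using uv by (intro arg_cong[of _ _ of_int]) (simp add: algebra_simps)
  then have eq: "of_int k * of_int v = (1 + of_nat p * of_int (- u) :: 'a)"
    by (simp add: mult.commute)
  then obtain d where d: "d \<in> R" "of_int k * of_int v * d = (1 :: 'a)"
    using one_plus_p_invertible[of "of_int (- u)"] by (metis of_int_mem)
  show ?thesis
    by (rule is_unit_inI[of _ "of_int v * d"]) (use d in \<open>auto simp: mult.assoc\<close>)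
qed

lemma inverse_of_nat_mem: "0 < k \<Longrightarrow> k < p \<Longrightarrow> inverse (of_nat k) \<in> R"
  using is_unit_in_of_int[of "int k"] nat_dvd_not_less[of k p] by (auto simp: is_unit_in_def)

lemma divide_of_nat_mem: "a \<in> R \<Longrightarrow> 0 < k \<Longrightarrow> k < p \<Longrightarrow> a / of_nat k \<in> R"
  using inverse_of_nat_mem[of k] by (auto simp: divide_inverse)

lemma inverse_fact_mem: "k < p \<Longrightarrow> inverse (fact k) \<in> R"
proof (induction k)
  case (Suc k)
  then have "inverse (of_nat (Suc k)) * inverse (fact k) \<in> R"
    by (intro mult_mem inverse_of_nat_mem) auto
  then show ?case by (simp add: mult.commute)
qed auto


subsection \<open>Congruences\<close>

text \<open>Divisibility is written as a product, not a quotient, so the modulus may vanish;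
  membership in \<open>R\<close> is left to the lemmas that need it.\<close>

definition congr :: "'a \<Rightarrow> 'a \<Rightarrow> 'a \<Rightarrow> bool" where
  "congr c a b \<longleftrightarrow> (\<exists>r\<in>R. a = b + c * r)"

lemma congrI: "r \<in> R \<Longrightarrow> a = b + c * r \<Longrightarrow> congr c a b"
  by (auto simp: congr_def)

lemma congrE: assumes "congr c a b" obtains r where "r \<in> R" "a = b + c * r"
  using assms by (auto simp: congr_def)

lemma congr_refl [simp, intro]: "congr c a a"
  by (rule congrI[of 0]) auto

lemma congr_sym: "congr c a b \<Longrightarrow> congr c b a"
  by (erule congrE, rule congrI[OF uminus_mem]) (auto simp: algebra_simps)

lemma congr_trans [trans]: "congr d a b \<Longrightarrow> congr d b c \<Longrightarrow> congr d a c"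
  unfolding congr_def by (auto intro!: bexI[OF _ add_mem] simp: algebra_simps)

lemma congr_add: "congr d a b \<Longrightarrow> congr d a' b' \<Longrightarrow> congr d (a + a') (b + b')"
  unfolding congr_def by (auto intro!: bexI[OF _ add_mem] simp: algebra_simps)

lemma congr_uminus: "congr d a b \<Longrightarrow> congr d (- a) (- b)"
  by (erule congrE, rule congrI[OF uminus_mem]) (auto simp: algebra_simps)

lemma congr_diff: "congr d a b \<Longrightarrow> congr d a' b' \<Longrightarrow> congr d (a - a') (b - b')"
  using congr_add[of d a b "- a'" "- b'"] congr_uminus[of d a' b'] by simp

lemma congr_mult:
  assumes "congr d a b" "congr d a' b'" "b \<in> R" "b' \<in> R" "d \<in> R"
  shows "congr d (a * a') (b * b')"
proof -
  obtain r s where "r \<in> R" "a = b + d * r" "s \<in> R" "a' = b' + d * s"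
    using assms by (auto elim!: congrE)
  then show ?thesis using assms
    by (intro congrI[of "b * s + r * b' + d * r * s"]) (auto simp: algebra_simps)
qed

lemma congr_power: "congr d a b \<Longrightarrow> b \<in> R \<Longrightarrow> d \<in> R \<Longrightarrow> congr d (a ^ n) (b ^ n)"
  by (induction n) (auto intro!: congr_mult)

lemma congr_sum: "(\<And>i. i \<in> A \<Longrightarrow> congr d (f i) (g i)) \<Longrightarrow> congr d (sum f A) (sum g A)"
  by (induction A rule: infinite_finite_induct) (auto intro!: congr_add)

lemma congr_scale: "congr d a b \<Longrightarrow> congr (c * d) (c * a) (c * b)"
  by (auto simp: congr_def algebra_simps)

lemma congr_mult_left: "congr d a b \<Longrightarrow> c \<in> R \<Longrightarrow> congr d (c * a) (c * b)"
  unfolding congr_def by (auto intro!: bexI[OF _ mult_mem] simp: algebra_simps)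

lemma congr_modulus: "congr (c * d) a b \<Longrightarrow> d \<in> R \<Longrightarrow> congr c a b"
  unfolding congr_def by (auto intro!: bexI[OF _ mult_mem] simp: algebra_simps)

lemma congr_mem: "congr d a b \<Longrightarrow> b \<in> R \<Longrightarrow> d \<in> R \<Longrightarrow> a \<in> R"
  by (auto elim!: congrE)

lemma congr_0_mult: "r \<in> R \<Longrightarrow> congr c (c * r) 0"
  by (rule congrI) auto

lemma is_unit_in_congr_1: "congr (of_nat p) a 1 \<Longrightarrow> is_unit_in a"
  by (auto elim!: congrE intro: is_unit_in_one_plus_p)

text \<open>The geometric sum exhibits \<open>1 - e\<close> as a divisor of
  \<open>1 - e ^ k\<close>, which is congruent to 1 modulo \<open>p\<close>.\<close>

lemma is_unit_in_power_congr_0: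
  assumes e: "e \<in> R" and k: "congr (of_nat p) (e ^ k) 0"
  shows "is_unit_in (1 - e)"
proof -
  have "congr (of_nat p) (1 - e ^ k) (1 - 0)"
    using k by (intro congr_diff) auto
  then have "is_unit_in (1 - e ^ k)"
    by (intro is_unit_in_congr_1) simp
  moreover have "1 - e ^ k = (1 - e) * (\<Sum>i<k. e ^ i)"
    by (simp add: one_diff_power_eq)
  ultimately show ?thesis using e
    by (intro is_unit_inI[of _ "(\<Sum>i<k. e ^ i) * inverse (1 - e ^ k)"])
       (auto dest: is_unit_inD simp: mult.assoc[symmetric] simp del: inverse_mult_distrib)
qed

text \<open>In the factorisation of \<open>a ^ p - b ^ p\<close> by \<open>a - b\<close> the
  cofactor is congruent to \<open>p * b ^ (p - 1)\<close>, so both factors are divisible by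
  \<open>p\<close>.\<close>

lemma congr_power_p:
  assumes "congr (of_nat p) a b" "b \<in> R"
  shows "congr (of_nat p ^ 2) (a ^ p) (b ^ p)"
proof -
  obtain r where r: "r \<in> R" "a = b + of_nat p * r" using assms by (auto elim!: congrE)
  have "congr (of_nat p) (\<Sum>i<p. b ^ (p - Suc i) * a ^ i) (\<Sum>i<p. b ^ (p - Suc i) * b ^ i)"
    using assms by (intro congr_sum congr_mult congr_power) auto
  also have "(\<Sum>i<p. b ^ (p - Suc i) * b ^ i) = (\<Sum>i<p. b ^ (p - 1))"
    by (intro sum.cong) (auto simp: power_add[symmetric])
  also have "congr (of_nat p) \<dots> 0"
    using assms by (intro congrI[of "b ^ (p - 1)"]) auto
  finally obtain s where s: "s \<in> R" "(\<Sum>i<p. b ^ (p - Suc i) * a ^ i) = of_nat p * s"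
    by (auto elim!: congrE)
  have "a ^ p - b ^ p = (a - b) * (\<Sum>i<p. b ^ (p - Suc i) * a ^ i)"
    by (rule power_diff_sumr2)
  then show ?thesis using r s
    by (intro congrI[of "r * s"]) (auto simp: power2_eq_square algebra_simps)
qed

subsection \<open>Truncated evaluation of power series\<close>

text \<open>Values of power series are truncated, so that congruences replace convergence.\<close>

definition trunc_eval :: "nat \<Rightarrow> rat fps \<Rightarrow> 'a \<Rightarrow> 'a" where
  "trunc_eval N F x = (\<Sum>k<N. of_rat (F $ k) * x ^ k)"

definition integral_below :: "nat \<Rightarrow> rat fps \<Rightarrow> bool" where
  "integral_below N F \<longleftrightarrow> (\<forall>k<N. of_rat (F $ k) \<in> R)"

lemma integral_below_1: "integral_below N 1"
  by (auto simp: integral_below_def fps_one_nth)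

lemma integral_below_mult: "integral_below N F \<Longrightarrow> integral_below N G \<Longrightarrow> integral_below N (F * G)"
  by (auto simp: integral_below_def fps_mult_nth of_rat_sum of_rat_mult intro!: sum_mem mult_mem)

lemma integral_below_power: "integral_below N F \<Longrightarrow> integral_below N (F ^ n)"
  by (induction n) (auto intro: integral_below_1 integral_below_mult)

lemma integral_below_diff: "integral_below N F \<Longrightarrow> integral_below N G \<Longrightarrow> integral_below N (F - G)"
  by (auto simp: integral_below_def of_rat_diff)

lemma integral_below_mono: "integral_below N F \<Longrightarrow> M \<le> N \<Longrightarrow> integral_below M F"
  by (auto simp: integral_below_def)

text \<open>With constant coefficient 1 the recursion for the coefficients of \<open>G\<close> needs
  no division.\<close>

lemma integral_below_inverse:
  assumes FG: "F * G = 1" and F0: "F $ 0 = 1" and F: "integral_below N F"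
  shows "integral_below N G"
proof -
  have "of_rat (G $ k) \<in> R" if "k < N" for k
    using that
  proof (induction k rule: less_induct)
    case (less k)
    have "(1 :: rat fps) $ k = (\<Sum>i=0..k. F $ i * G $ (k - i))"
      by (simp add: FG[symmetric] fps_mult_nth)
    also have "\<dots> = G $ k + (\<Sum>i\<in>{1..k}. F $ i * G $ (k - i))"
      by (simp add: sum.atLeast_Suc_atMost F0)
    finally have "G $ k = (1 :: rat fps) $ k - (\<Sum>i\<in>{1..k}. F $ i * G $ (k - i))" by simp
    then have "of_rat (G $ k) =
        (of_rat ((1 :: rat fps) $ k) - (\<Sum>i\<in>{1..k}. of_rat (F $ i) * of_rat (G $ (k - i))) :: 'a)"
      by (simp add: of_rat_diff of_rat_sum of_rat_mult)
    also have "\<dots> \<in> R"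
      using less.prems F by (intro diff_mem sum_mem mult_mem less.IH)
        (auto simp: integral_below_def fps_one_nth)
    finally show ?case .
  qed
  then show ?thesis by (auto simp: integral_below_def)
qed

lemma trunc_eval_mem: "integral_below N F \<Longrightarrow> x \<in> R \<Longrightarrow> trunc_eval N F x \<in> R"
  by (auto simp: trunc_eval_def integral_below_def)

lemma trunc_eval_cong: "(\<And>k. k < N \<Longrightarrow> F $ k = G $ k) \<Longrightarrow> trunc_eval N F x = trunc_eval N G x"
  by (auto simp: trunc_eval_def)

lemma trunc_eval_1: "N > 0 \<Longrightarrow> trunc_eval N 1 x = 1"
  by (cases N) (simp_all add: trunc_eval_def sum.lessThan_Suc_shift fps_one_nth del: sum.lessThan_Suc)

lemma trunc_eval_diff: "trunc_eval N (F - G) x = trunc_eval N F x - trunc_eval N G x"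
  by (simp add: trunc_eval_def of_rat_diff algebra_simps sum_subtractf)

lemma trunc_eval_const_mult: "trunc_eval N (fps_const c * F) x = of_rat c * trunc_eval N F x"
  by (simp add: trunc_eval_def of_rat_mult sum_distrib_left mult.assoc)

lemma trunc_eval_sum: "trunc_eval N (\<Sum>i\<in>A. F i) x = (\<Sum>i\<in>A. trunc_eval N (F i) x)"
  by (simp add: trunc_eval_def of_rat_sum fps_sum_nth sum_distrib_right sum.swap[of _ A])

lemma trunc_eval_arg_cong:
  assumes "congr d x y" "y \<in> R" "d \<in> R" "integral_below N F"
  shows "congr d (trunc_eval N F x) (trunc_eval N F y)"
  unfolding trunc_eval_def using assms by (intro congr_sum congr_mult_left congr_power)
    (auto simp: integral_below_def)

text \<open>The two values differ only by products of terms of total degree at least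
  \<open>N\<close>.\<close>

lemma trunc_eval_mult:
  assumes F: "integral_below N F" and G: "integral_below N G" and x: "x \<in> R"
  shows "congr (x ^ N) (trunc_eval N (F * G) x) (trunc_eval N F x * trunc_eval N G x)"
proof -
  let ?h = "\<lambda>i j. of_rat (F $ i) * of_rat (G $ j) * x ^ (i + j)"
  define A B where "A = {(i, j). i + j < N}" and "B = {(i, j). i < N \<and> j < N \<and> N \<le> i + j}"
  have AB: "A \<union> B = {..<N} \<times> {..<N}" "A \<inter> B = {}"
    by (auto simp: A_def B_def)
  then have fin: "finite A" "finite B"
    by (metis finite_Un finite_SigmaI finite_lessThan)+
  have "trunc_eval N F x * trunc_eval N G x = (\<Sum>(i,j)\<in>{..<N} \<times> {..<N}. ?h i j)"
    by (simp add: trunc_eval_def sum_product sum.cartesian_product power_add algebra_simps)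
  also have "\<dots> = (\<Sum>(i,j)\<in>A. ?h i j) + (\<Sum>(i,j)\<in>B. ?h i j)"
    unfolding AB(1)[symmetric] using fin AB(2) by (rule sum.union_disjoint)
  also have "(\<Sum>(i,j)\<in>A. ?h i j) = (\<Sum>k<N. \<Sum>i\<le>k. ?h i (k - i))"
    unfolding A_def by (rule sum.triangle_reindex)
  also have "\<dots> = trunc_eval N (F * G) x"
    by (simp add: trunc_eval_def fps_mult_nth of_rat_sum of_rat_mult sum_distrib_right atMost_atLeast0)
  finally have eq: "trunc_eval N F x * trunc_eval N G x = trunc_eval N (F * G) x + (\<Sum>(i,j)\<in>B. ?h i j)" .
  have "congr (x ^ N) (\<Sum>(i,j)\<in>B. ?h i j) (\<Sum>(i,j)\<in>B. 0)"
  proof (intro congr_sum, clarify)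
    fix i j assume "(i, j) \<in> B"
    then have ij: "i < N" "j < N" "N \<le> i + j" by (auto simp: B_def)
    then have "x ^ (i + j) = x ^ N * x ^ (i + j - N)"
      by (simp flip: power_add)
    then show "congr (x ^ N) (?h i j) 0"
      using ij F G x
      by (intro congrI[of "of_rat (F $ i) * of_rat (G $ j) * x ^ (i + j - N)"])
         (auto simp: integral_below_def)
  qed
  then have "congr (x ^ N) (trunc_eval N F x * trunc_eval N G x) (trunc_eval N (F * G) x + 0)"
    unfolding eq by (intro congr_add) auto
  then show ?thesis by (simp add: congr_sym)
qed

lemma trunc_eval_power:
  assumes F: "integral_below N F" and x: "x \<in> R" and N: "N > 0"
  shows "congr (x ^ N) (trunc_eval N (F ^ n) x) (trunc_eval N F x ^ n)"
proof (induction n)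
  case 0
  then show ?case using N by (simp add: trunc_eval_1)
next
  case (Suc n)
  note IH = this
  have "congr (x ^ N) (trunc_eval N (F * F ^ n) x) (trunc_eval N F x * trunc_eval N (F ^ n) x)"
    using F x by (intro trunc_eval_mult integral_below_power)
  also have "congr (x ^ N) \<dots> (trunc_eval N F x * trunc_eval N F x ^ n)"
    using IH F x by (intro congr_mult_left trunc_eval_mem)
  finally show ?case by simp
qed

text \<open>Since \<open>G\<close> has no constant term, \<open>G ^ i\<close> with
  \<open>i >= N\<close> contributes nothing below degree \<open>N\<close>; the composition reduces
  to finitely many powers of \<open>G\<close>.\<close>

lemma trunc_eval_compose:
  assumes F: "integral_below N F" and G: "integral_below N G" and G0: "G $ 0 = 0" and x: "x \<in> R"
  shows "congr (x ^ N) (trunc_eval N (F oo G) x) (trunc_eval N F (trunc_eval N G x))"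
proof (cases "N = 0")
  case True
  then show ?thesis by (simp add: trunc_eval_def)
next
  case False
  have "(F oo G) $ k = (\<Sum>i<N. fps_const (F $ i) * G ^ i) $ k" if "k < N" for k
  proof -
    have "(F oo G) $ k = (\<Sum>i=0..k. F $ i * (G ^ i $ k))"
      by (rule fps_compose_nth)
    also have "\<dots> = (\<Sum>i<N. F $ i * (G ^ i $ k))"
      using that G0 by (intro sum.mono_neutral_left) (auto simp: startsby_zero_power_prefix)
    finally show ?thesis by (simp add: fps_sum_nth)
  qed
  then have "trunc_eval N (F oo G) x = trunc_eval N (\<Sum>i<N. fps_const (F $ i) * G ^ i) x"
    by (rule trunc_eval_cong)
  also have "\<dots> = (\<Sum>i<N. of_rat (F $ i) * trunc_eval N (G ^ i) x)"
    by (simp add: trunc_eval_sum trunc_eval_const_mult)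
  also have "congr (x ^ N) \<dots> (\<Sum>i<N. of_rat (F $ i) * trunc_eval N G x ^ i)"
    using F G x False by (intro congr_sum congr_mult_left trunc_eval_power)
      (auto simp: integral_below_def)
  finally show ?thesis by (simp add: trunc_eval_def)
qed

lemma integral_below_exp: "integral_below p (fps_exp 1)"
  unfolding integral_below_def
proof (intro allI impI)
  fix k assume "k < p"
  moreover have "of_rat (fact k) = (fact k :: 'a)"
    by (metis of_nat_fact of_rat_of_nat_eq)
  ultimately show "of_rat (fps_exp 1 $ k) \<in> R"
    using inverse_fact_mem[of k] by (simp add: of_rat_divide divide_inverse of_rat_inverse)
qed

lemma integral_below_ln: "integral_below p (fps_ln 1)"
proof -
  have "of_rat (fps_ln 1 $ k) \<in> R" if "k < p" for k
  proof (cases "k = 0")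
    case False
    have "of_rat (fps_ln 1 $ k) = ((- 1) ^ (k - 1) / of_nat k :: 'a)"
      using False by (simp add: fps_ln_nth of_rat_divide of_rat_power of_rat_minus)
    also have "\<dots> \<in> R" using False that by (intro divide_of_nat_mem) auto
    finally show ?thesis .
  qed auto
  then show ?thesis by (auto simp: integral_below_def)
qed

lemma trunc_eval_Suc:
  "trunc_eval (Suc N) F x = of_rat (F $ 0) + x * trunc_eval N (fps_shift 1 F) x"
  by (simp add: trunc_eval_def sum.lessThan_Suc_shift sum_distrib_left algebra_simps
           del: sum.lessThan_Suc)

lemma integral_below_shift: "integral_below (Suc N) F \<Longrightarrow> integral_below N (fps_shift 1 F)"
  by (auto simp: integral_below_def)

subsection \<open>The binomial expansion of a $p$-th power\<close>

text \<open>By Pascal's rule two neighbouring coefficients add up to \<open>p choose Suc k\<close>,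
  which is divisible by \<open>p\<close>; so the sign alternates modulo \<open>p\<close>.\<close>

lemma choose_pred_cong:
  assumes "k < p"
  shows "\<exists>z. int ((p - 1) choose k) = (- 1) ^ k + int p * z"
  using assms
proof (induction k)
  case (Suc k)
  then obtain z where z: "int ((p - 1) choose k) = (- 1) ^ k + int p * z" by auto
  have "p dvd (p choose Suc k)"
    using Suc.prems prime_p by (intro dvd_choose_prime) auto
  then obtain y where y: "p choose Suc k = p * y" by auto
  have "p choose Suc k = ((p - 1) choose k) + ((p - 1) choose Suc k)"
    using p_gt_1 by (cases p) auto
  then have "int ((p - 1) choose Suc k) = int (p * y) - int ((p - 1) choose k)"
    using y by linarith
  then show ?case using z by (intro exI[of _ "int y - z"]) (simp add: algebra_simps)
qed (auto intro: exI[of _ 0])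

text \<open>From \<open>k * (p choose k) = p * ((p - 1) choose (k - 1))\<close>. This is where the
  logarithm enters: its coefficients are those of the binomial expansion divided by
  \<open>p\<close>, up to multiples of \<open>p\<close>.\<close>

lemma choose_p_cong:
  assumes k: "0 < k" "k < p"
  shows "congr (of_nat p ^ 2) (of_nat (p choose k)) (of_nat p * of_rat (fps_ln 1 $ k))"
proof -
  obtain z where z: "int ((p - 1) choose (k - 1)) = (- 1) ^ (k - 1) + int p * z"
    using choose_pred_cong[of "k - 1"] k by (meson less_imp_diff_less)
  have "k * (p choose k) = p * ((p - 1) choose (k - 1))"
    using k by (intro times_binomial_minus1_eq)
  then have "of_nat (k * (p choose k)) = (of_nat (p * ((p - 1) choose (k - 1))) :: 'a)"
    by (rule arg_cong)
  also have "\<dots> = of_nat p * of_int (int ((p - 1) choose (k - 1)))" by simp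
  finally have "of_nat k * of_nat (p choose k)
      = of_nat p * ((- 1) ^ (k - 1) + of_nat p * of_int z :: 'a)"
    unfolding z by simp
  then have "of_nat (p choose k)
      = of_nat p * ((- 1) ^ (k - 1) / of_nat k) + of_nat p ^ 2 * (of_int z / of_nat k :: 'a)"
    using k by (simp add: field_simps power2_eq_square)
  moreover have "of_rat (fps_ln 1 $ k) = ((- 1) ^ (k - 1) / of_nat k :: 'a)"
    using k by (simp add: fps_ln_nth of_rat_divide of_rat_power of_rat_minus)
  ultimately show ?thesis
    using divide_of_nat_mem[of "of_int z" k] k by (auto intro!: congrI)
qed

text \<open>The factor \<open>Y\<close> is kept in the modulus because it is cancelled later for
  \<open>Y = T\<close> and adds precision when \<open>Y\<close> is divisible by a power of
  \<open>p\<close>.\<close>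

lemma one_plus_power_p:
  assumes Y: "Y \<in> R"
  shows "congr (of_nat p ^ 2 * Y) ((1 + Y) ^ p) (1 + of_nat p * trunc_eval p (fps_ln 1) Y + Y ^ p)"
proof -
  have set: "{..p} = insert 0 (insert p {0<..<p})" "{..<p} = insert 0 {0<..<p}"
    using p_gt_1 by auto
  have "(1 + Y) ^ p = (\<Sum>k\<le>p. of_nat (p choose k) * Y ^ k)"
    using binomial_ring[of Y 1 p] by (simp add: add.commute)
  also have "\<dots> = 1 + (\<Sum>k\<in>{0<..<p}. of_nat (p choose k) * Y ^ k) + Y ^ p"
    unfolding set using p_gt_1 by simp
  also have "congr (of_nat p ^ 2 * Y) \<dots>
      (1 + (\<Sum>k\<in>{0<..<p}. of_nat p * of_rat (fps_ln 1 $ k) * Y ^ k) + Y ^ p)"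
  proof (intro congr_add congr_refl congr_sum)
    fix k assume "k \<in> {0<..<p}"
    then have k: "0 < k" "k < p" by auto
    from choose_p_cong[OF k] obtain r where r: "r \<in> R"
      "of_nat (p choose k) = of_nat p * of_rat (fps_ln 1 $ k) + of_nat p ^ 2 * r"
      by (auto elim!: congrE)
    have "Y ^ k = Y * Y ^ (k - 1)" using k by (simp flip: power_Suc)
    then show "congr (of_nat p ^ 2 * Y) (of_nat (p choose k) * Y ^ k)
        (of_nat p * of_rat (fps_ln 1 $ k) * Y ^ k)"
      unfolding r(2) using r Y
      by (intro congrI[of "r * Y ^ (k - 1)"]) (auto simp: algebra_simps)
  qed
  also have "(\<Sum>k\<in>{0<..<p}. of_nat p * of_rat (fps_ln 1 $ k) * Y ^ k)
      = of_nat p * trunc_eval p (fps_ln 1) Y"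
    unfolding trunc_eval_def set by (simp add: sum_distrib_left mult.assoc)
  finally show ?thesis .
qed

lemma congr_p_scale: "congr (of_nat p) a b \<Longrightarrow> congr (of_nat p ^ 2) (of_nat p * a) (of_nat p * b)"
  using congr_scale[of "of_nat p" a b "of_nat p"] by (simp add: power2_eq_square)

lemma trunc_eval_ln_mem: "Y \<in> R \<Longrightarrow> trunc_eval p (fps_ln 1) Y \<in> R"
  by (intro trunc_eval_mem integral_below_ln)

text \<open>Since \<open>p >= 2\<close>, the coefficients 0 and 1 can be split off. This presents
  \<open>PI\<close> as \<open>T\<close> times a unit and controls the quadratic error when powers
  are lifted.\<close>

lemma trunc_eval_ln_factor:
  assumes Y: "Y \<in> R"
  shows "\<exists>s\<in>R. trunc_eval p (fps_ln 1) Y = Y * (1 + Y * s)"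
proof -
  define N where "N = p - 2"
  have N: "p = Suc (Suc N)" using p_gt_1 by (simp add: N_def)
  have "trunc_eval p (fps_ln 1) Y = Y * (1 + Y * trunc_eval N (fps_shift 1 (fps_shift 1 (fps_ln 1))) Y)"
    unfolding N trunc_eval_Suc by (simp add: fps_ln_nth)
  moreover have "trunc_eval N (fps_shift 1 (fps_shift 1 (fps_ln 1))) Y \<in> R"
    using integral_below_ln Y by (intro trunc_eval_mem integral_below_shift) (simp_all flip: N)
  ultimately show ?thesis by blast
qed

section \<open>Frobenius and Fermat congruences modulo p\<close>

lemma frobenius_cong:
  assumes Y: "Y \<in> R"
  shows "congr (of_nat p) ((1 + Y) ^ p) (1 + Y ^ p)"
proof -
  have "congr (of_nat p) ((1 + Y) ^ p) (1 + of_nat p * trunc_eval p (fps_ln 1) Y + Y ^ p)"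
    using one_plus_power_p[OF Y] Y
    by (intro congr_modulus[of "of_nat p" "of_nat p * Y"]) (auto simp: power2_eq_square mult.assoc)
  also have "congr (of_nat p) \<dots> (1 + Y ^ p)"
    using trunc_eval_ln_mem[OF Y] by (intro congrI) auto
  finally show ?thesis .
qed

lemma fermat_cong_nat: "congr (of_nat p) (of_nat a ^ p) (of_nat a)"
proof (induction a)
  case 0
  then show ?case using p_gt_1 by (simp add: power_0_left)
next
  case (Suc a)
  have "congr (of_nat p) (of_nat (Suc a) ^ p) (1 + of_nat a ^ p)"
    using frobenius_cong[of "of_nat a"] by simp
  also have "congr (of_nat p) \<dots> (1 + of_nat a)"
    using Suc by (intro congr_add) auto
  finally show ?case by simp
qed

lemma of_int_cong_nat: "congr (of_nat p) (of_int a) (of_nat (nat (a mod int p)))"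
proof -
  have "int (nat (a mod int p)) = a mod int p"
    using p_gt_1 by simp
  moreover have "a = a mod int p + int p * (a div int p)" by simp
  ultimately have "a = int (nat (a mod int p)) + int p * (a div int p)" by simp
  then have "of_int a = (of_int (int (nat (a mod int p)) + int p * (a div int p)) :: 'a)"
    by (rule arg_cong)
  then show ?thesis
    by (intro congrI[of "of_int (a div int p)"]) auto
qed

lemma fermat_cong: "congr (of_nat p) (of_int a ^ p) (of_int a)"
proof -
  have "congr (of_nat p) (of_int a ^ p) (of_nat (nat (a mod int p)) ^ p)"
    by (intro congr_power of_int_cong_nat) auto
  also have "congr (of_nat p) \<dots> (of_nat (nat (a mod int p)))"
    by (rule fermat_cong_nat)
  also have "congr (of_nat p) \<dots> (of_int a)"
    by (rule congr_sym, rule of_int_cong_nat)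
  finally show ?thesis .
qed

lemma fermat_cong_unit:
  assumes "\<not> int p dvd a"
  shows "congr (of_nat p) (of_int a ^ (p - 1)) 1"
proof -
  have u: "is_unit_in (of_int a)" using assms by (rule is_unit_in_of_int)
  have "congr (of_nat p) (inverse (of_int a) * of_int a ^ p) (inverse (of_int a) * of_int a)"
    using u by (intro congr_mult_left fermat_cong is_unit_inD)
  moreover have "of_int a ^ p = (of_int a * of_int a ^ (p - 1) :: 'a)"
    using p_gt_1 by (simp flip: power_Suc)
  ultimately show ?thesis using is_unit_inD(2)[OF u] by (simp flip: mult.assoc)
qed

end

section \<open>A $p$-th root of unity\<close>

text \<open>The shift of \<open>e\<^sup>X\<close> is \<open>(e\<^sup>X - 1) / X\<close>.\<close>

abbreviation exp_quot :: "rat fps" where "exp_quot \<equiv> fps_shift 1 (fps_exp 1)"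
abbreviation bern_fps :: "rat fps" where "bern_fps \<equiv> fps_X / (fps_exp 1 - 1)"

section \<open>Identities between the exponential, logarithmic and Bernoulli series\<close>

lemma X_mult_exp_quot: "fps_X * exp_quot = fps_exp 1 - 1"
  by (rule fps_ext) (auto simp: fps_X_mult_nth)

lemma exp_quot_bern_fps: "exp_quot * bern_fps = 1"
proof -
  have "fps_X * (exp_quot * bern_fps) = fps_X * 1"
    using bernoulli_fps_mult by (simp add: X_mult_exp_quot[symmetric] mult_ac)
  then show ?thesis by (subst (asm) mult_left_cancel) auto
qed

lemma exp_compose_ln: "fps_exp 1 oo fps_ln 1 = (1 + fps_X :: rat fps)"
proof -
  have "(fps_exp 1 - 1) oo fps_ln 1 = (fps_X :: rat fps)"
    using fps_inv_fps_exp_compose(2)[of 1] fps_ln_fps_exp_inv[of "1 :: rat"] by simp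
  then show ?thesis by (simp add: fps_compose_sub_distrib algebra_simps)
qed

text \<open>Logarithmic differentiation: for \<open>g = exp_quot\<close>, the derivative of
  \<open>X g = e^X - 1\<close> gives \<open>g + X g' = 1 + X g\<close>. Division by \<open>g\<close>
  turns this into \<open>1 + X g' / g = bern_fps + X\<close>, and coefficients are compared.\<close>

lemma ln_compose_exp_quot_nth:
  assumes "k > 0"
  shows "of_nat k * (fps_ln 1 oo (exp_quot - 1)) $ k = (if k = 1 then 1 else 0) + bern_fps $ k"
proof -
  define L where "L = fps_ln 1 oo (exp_quot - 1)"
  have e0: "(exp_quot - 1) $ 0 = 0" by simp
  have inv: "inverse exp_quot = bern_fps"
    by (rule fps_inverse_unique[OF exp_quot_bern_fps])
  have "fps_deriv L = (inverse (1 + fps_X) oo (exp_quot - 1)) * fps_deriv (exp_quot - 1)"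
    unfolding L_def fps_compose_deriv[OF e0] fps_ln_deriv by simp
  also have "inverse (1 + fps_X) oo (exp_quot - 1) = inverse ((1 + fps_X) oo (exp_quot - 1))"
    by (rule fps_inverse_compose) (use e0 in auto)
  also have "(1 + fps_X) oo (exp_quot - 1) = exp_quot"
    using e0 by (simp add: fps_compose_add_distrib)
  finally have dL: "fps_deriv L = bern_fps * fps_deriv exp_quot"
    by (simp add: inv[simplified])
  have "fps_deriv (fps_X * exp_quot) = fps_deriv (fps_exp 1 - 1)"
    by (simp only: X_mult_exp_quot)
  then have "exp_quot + fps_X * fps_deriv exp_quot = fps_exp 1"
    by (simp add: fps_deriv_mult add.commute)
  also have "\<dots> = 1 + fps_X * exp_quot" unfolding X_mult_exp_quot by simp
  finally have "bern_fps * (exp_quot + fps_X * fps_deriv exp_quot) = bern_fps * (1 + fps_X * exp_quot)"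
    by (rule arg_cong)
  then have "exp_quot * bern_fps + fps_X * (bern_fps * fps_deriv exp_quot)
      = bern_fps + fps_X * (exp_quot * bern_fps)"
    by (simp only: distrib_left mult_1_left mult_1_right mult_ac)
  then have "1 + fps_X * fps_deriv L = bern_fps + fps_X"
    unfolding exp_quot_bern_fps dL by simp
  then have "(1 + fps_X * fps_deriv L) $ k = (bern_fps + fps_X) $ k" by simp
  then show ?thesis using assms unfolding L_def[symmetric]
    by (cases k) (auto simp: fps_X_mult_nth fps_X_nth)
qed

lemma bern_fps_nth_0: "bern_fps $ 0 = 1"
  using arg_cong[OF exp_quot_bern_fps, of "\<lambda>F. F $ 0"] by simp

lemma bern_fps_nth_1: "bern_fps $ 1 = - (1 / 2)"
  using arg_cong[OF exp_quot_bern_fps, of "\<lambda>F. F $ 1"] bern_fps_nth_0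
  by (simp add: fps_mult_nth numeral_2_eq_2)


section \<open>The element \<pi> and its power of exponent p - 1\<close>

locale p_subring_root = p_subring +
  fixes \<zeta> :: 'a
  assumes zeta_mem: "\<zeta> \<in> R" and zeta_power: "\<zeta> ^ p = 1" and zeta_neq_1: "\<zeta> \<noteq> 1"
begin

definition T :: 'a where "T = \<zeta> - 1"

text \<open>This is the \<pi> of the theorem, since \<open>(-1) ^ (k - 1) * T ^ k\<close> equals
  \<open>- (1 - \<zeta>) ^ k\<close> for positive \<open>k\<close>.\<close>

definition PI :: 'a where "PI = trunc_eval p (fps_ln 1) T"

lemma T_mem: "T \<in> R" and T_nz: "T \<noteq> 0"
  using zeta_mem zeta_neq_1 by (auto simp: T_def)

lemma PI_mem: "PI \<in> R"
  unfolding PI_def by (intro trunc_eval_ln_mem T_mem)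

lemma T_power_p: "congr (of_nat p ^ 2 * T) (T ^ p) (- of_nat p * PI)"
proof -
  obtain r where r: "r \<in> R" "(1 + T) ^ p = 1 + of_nat p * PI + T ^ p + of_nat p ^ 2 * T * r"
    using one_plus_power_p[OF T_mem] unfolding PI_def by (auto elim!: congrE)
  have "(1 + T) ^ p = 1" by (simp add: T_def zeta_power)
  moreover have "T ^ p = (1 + T) ^ p - 1 - of_nat p * PI - of_nat p ^ 2 * T * r"
    using r(2) by simp
  ultimately have "T ^ p = - of_nat p * PI + of_nat p ^ 2 * T * (- r)" by simp
  then show ?thesis using r(1) by (intro congrI[of "- r"]) auto
qed

lemma T_power_p_cong_0: "congr (of_nat p) (T ^ p) 0"
proof -
  have "congr (of_nat p) (T ^ p) (- of_nat p * PI)"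
    using T_power_p T_mem by (intro congr_modulus[of "of_nat p" "of_nat p * T"])
      (auto simp: power2_eq_square mult.assoc)
  also have "congr (of_nat p) \<dots> 0"
    using PI_mem by (intro congrI[of "- PI"]) auto
  finally show ?thesis .
qed

text \<open>Because \<open>T ^ p\<close> vanishes modulo \<open>p\<close>, the element
  \<open>1 - u\<close> is nilpotent modulo \<open>p\<close>.\<close>

lemma is_unit_in_one_plus_T:
  assumes s: "s \<in> R" and u: "congr (of_nat p) u (1 + T * s)"
  shows "is_unit_in u"
proof -
  have e: "congr (of_nat p) (1 - u) (1 - (1 + T * s))"
    using u by (intro congr_diff) auto
  have "congr (of_nat p) ((1 - u) ^ p) ((1 - (1 + T * s)) ^ p)"
    using s T_mem e by (intro congr_power) auto
  also have "(1 - (1 + T * s)) ^ p = (- s) ^ p * T ^ p"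
    by (simp flip: power_mult_distrib add: mult.commute)
  also have "congr (of_nat p) \<dots> ((- s) ^ p * 0)"
    using s T_power_p_cong_0 by (intro congr_mult_left) auto
  finally have "congr (of_nat p) ((1 - u) ^ p) 0" by simp
  moreover have "1 - u \<in> R"
    using s T_mem by (intro congr_mem[OF e]) auto
  ultimately have "is_unit_in (1 - (1 - u))"
    by (intro is_unit_in_power_congr_0)
  then show ?thesis by simp
qed

text \<open>One factor \<open>T\<close> is cancelled from
  \<open>T ^ p = - p * PI + p^2 * T * r\<close> after substituting \<open>PI = T * v\<close>; what
  remains besides \<open>- p\<close> is \<open>u = v - p * r\<close>. Frobenius applied to
  \<open>v = 1 + T * s\<close> gives the last property.\<close>

lemma T_power_pred:
  obtains v u where "is_unit_in v" "is_unit_in u" "PI = T * v" "T ^ (p - 1) = - of_nat p * u"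
    "congr (of_nat p) u v" "congr (of_nat p) (v ^ p) 1"
proof -
  obtain s where s: "s \<in> R" "PI = T * (1 + T * s)"
    using trunc_eval_ln_factor[OF T_mem] unfolding PI_def by auto
  obtain r where r: "r \<in> R" "T ^ p = - of_nat p * PI + of_nat p ^ 2 * T * r"
    using T_power_p by (auto elim!: congrE)
  define v where "v = 1 + T * s"
  define u where "u = v + of_nat p * (- r)"
  have uv: "congr (of_nat p) u v"
    using r by (intro congrI[of "- r"]) (auto simp: u_def)
  have "T * T ^ (p - 1) = T ^ p"
    using p_gt_1 by (simp flip: power_Suc)
  also have "\<dots> = T * (- of_nat p * u)"
    unfolding r(2) s(2) u_def v_def by (simp add: algebra_simps power2_eq_square)
  finally have "T ^ (p - 1) = - of_nat p * u"
    using T_nz by (metis mult_left_cancel)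
  moreover have "is_unit_in v" "is_unit_in u"
    using s uv by (auto intro!: is_unit_in_one_plus_T simp: v_def)
  moreover have "congr (of_nat p) (v ^ p) 1"
  proof -
    have "congr (of_nat p) (v ^ p) (1 + (T * s) ^ p)"
      unfolding v_def using s T_mem by (intro frobenius_cong) auto
    also have "\<dots> = 1 + s ^ p * T ^ p"
      by (simp add: power_mult_distrib mult.commute)
    also have "congr (of_nat p) \<dots> (1 + s ^ p * 0)"
      using s T_power_p_cong_0 by (intro congr_add congr_mult_left) auto
    finally show ?thesis by simp
  qed
  ultimately show ?thesis
    using that[of v u] s uv by (simp add: v_def)
qed

lemma PI_nz: "PI \<noteq> 0"
  using T_power_pred T_nz by (metis is_unit_inD(2) mult_eq_0_iff)

text \<open>From \<open>PI = T * v\<close> the power is \<open>- p * v ^ (p - 1) * u\<close>. Modulo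
  \<open>p\<close> the factor \<open>u\<close> may be replaced by \<open>v\<close>, leaving
  \<open>v ^ p\<close>, which is congruent to 1.\<close>

theorem PI_power_pred: "congr (of_nat p ^ 2) (PI ^ (p - 1)) (- of_nat p)"
proof -
  obtain v u where vu: "is_unit_in v" "is_unit_in u" "PI = T * v" "T ^ (p - 1) = - of_nat p * u"
    "congr (of_nat p) u v" "congr (of_nat p) (v ^ p) 1"
    by (rule T_power_pred)
  have "congr (of_nat p) (v ^ (p - 1) * u) (v ^ (p - 1) * v)"
    using vu by (intro congr_mult_left power_mem is_unit_inD)
  also have "v ^ (p - 1) * v = v ^ p"
    using p_gt_1 by (simp flip: power_Suc2)
  also have "congr (of_nat p) \<dots> 1" by fact
  finally have "congr (of_nat p ^ 2) (- (of_nat p * (v ^ (p - 1) * u))) (- (of_nat p * 1))"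
    by (intro congr_uminus congr_p_scale)
  then show ?thesis
    unfolding vu(3) power_mult_distrib vu(4) by (simp add: algebra_simps)
qed

lemma PI_power_pred_cong_0: "congr (of_nat p) (PI ^ (p - 1)) 0"
proof -
  have "congr (of_nat p) (PI ^ (p - 1)) (- of_nat p)"
    using PI_power_pred by (intro congr_modulus[of "of_nat p" "of_nat p"]) (auto simp: power2_eq_square)
  also have "congr (of_nat p) \<dots> 0" by (intro congrI[of "- 1"]) auto
  finally show ?thesis .
qed

text \<open>Here \<open>T ^ p\<close> is \<open>p * PI\<close> times an element of \<open>R\<close>,
  so truncation errors of degree \<open>p\<close> at \<open>T\<close> vanish modulo
  \<open>p * PI\<close>.\<close>

lemma congr_T_power_imp:
  assumes "congr (T ^ p) a b"
  shows "congr (of_nat p * PI) a b"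
proof -
  obtain v u where vu: "is_unit_in v" "is_unit_in u" "PI = T * v" "T ^ (p - 1) = - of_nat p * u"
    by (rule T_power_pred)
  have "T ^ p = T * T ^ (p - 1)" using p_gt_1 by (simp flip: power_Suc)
  also have "\<dots> = of_nat p * PI * (- u * inverse v)"
    unfolding vu(4) unfolding vu(3) using is_unit_inD(2)[OF vu(1)] by simp
  finally have eq: "T ^ p = of_nat p * PI * (- u * inverse v)" .
  have "- u * inverse v \<in> R"
    using vu by (intro mult_mem uminus_mem is_unit_inD)
  with assms[unfolded eq] show ?thesis by (rule congr_modulus)
qed

lemma congr_PI_power_imp:
  assumes "congr (PI ^ p) a b"
  shows "congr (of_nat p * PI) a b"
proof -
  obtain c where c: "c \<in> R" "PI ^ (p - 1) = of_nat p * c"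
    using PI_power_pred_cong_0 by (auto elim!: congrE)
  have "PI ^ p = PI * PI ^ (p - 1)" using p_gt_1 by (simp flip: power_Suc)
  then have eq: "PI ^ p = of_nat p * PI * c" unfolding c by (simp only: mult_ac)
  show ?thesis using assms[unfolded eq] c(1) by (rule congr_modulus)
qed

text \<open>This is the truncation of \<open>exp (ln \<zeta>) = \<zeta>\<close>; the series of \<open>exp\<close> need not
  converge at \<open>PI\<close>.\<close>

lemma trunc_eval_exp_PI: "congr (of_nat p * PI) (trunc_eval p (fps_exp 1) PI) \<zeta>"
proof (rule congr_T_power_imp)
  have "congr (T ^ p) (trunc_eval p (fps_exp 1 oo fps_ln 1) T) (trunc_eval p (fps_exp 1) PI)"
    unfolding PI_def by (intro trunc_eval_compose integral_below_exp integral_below_ln T_mem) auto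
  moreover have "trunc_eval p (fps_exp 1 oo fps_ln 1) T = \<zeta>"
  proof -
    \<comment> \<open>As \<open>p >= 2\<close>, truncating \<open>1 + X\<close> below degree
      \<open>p\<close> loses nothing.\<close>
    define N where "N = p - 2"
    have N: "p = Suc (Suc N)" using p_gt_1 by (simp add: N_def)
    show ?thesis unfolding exp_compose_ln N trunc_eval_Suc
      by (simp add: trunc_eval_def T_def)
  qed
  ultimately show "congr (T ^ p) (trunc_eval p (fps_exp 1) PI) \<zeta>" by (simp add: congr_sym)
qed

lemma trunc_eval_exp_of_nat_PI:
  "congr (of_nat p * PI) (trunc_eval p (fps_exp 1) (of_nat a * PI)) (\<zeta> ^ a)"
proof -
  have "trunc_eval p (fps_exp 1) (of_nat a * PI) = trunc_eval p (fps_exp 1 ^ a) PI"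
    unfolding fps_exp_power_mult
    by (simp add: trunc_eval_def power_mult_distrib of_rat_divide of_rat_mult of_rat_power mult_ac)
  also have "congr (of_nat p * PI) \<dots> (trunc_eval p (fps_exp 1) PI ^ a)"
    using p_gt_1 by (intro congr_PI_power_imp trunc_eval_power integral_below_exp PI_mem) auto
  also have "congr (of_nat p * PI) \<dots> (\<zeta> ^ a)"
    using zeta_mem PI_mem by (intro congr_power trunc_eval_exp_PI) auto
  finally show ?thesis .
qed

text \<open>Up to multiples of \<open>p * PI\<close> both sides depend only on \<open>a\<close>
  modulo \<open>p\<close>, so \<open>a\<close> can be replaced by its nonnegative residue.\<close>

lemma trunc_eval_exp_of_int_PI:
  "congr (of_nat p * PI) (trunc_eval p (fps_exp 1) (of_int a * PI)) (\<zeta> powi a)"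
proof -
  define b where "b = nat (a mod int p)"
  have b: "int b = a mod int p" using p_gt_1 by (simp add: b_def)
  have "congr (PI * of_nat p) (PI * of_int a) (PI * of_nat b)"
    unfolding b_def by (intro congr_scale of_int_cong_nat)
  then have "congr (of_nat p * PI) (of_int a * PI) (of_nat b * PI)" by (simp add: mult.commute)
  then have "congr (of_nat p * PI) (trunc_eval p (fps_exp 1) (of_int a * PI))
      (trunc_eval p (fps_exp 1) (of_nat b * PI))"
    using PI_mem by (intro trunc_eval_arg_cong integral_below_exp) auto
  also have "congr (of_nat p * PI) \<dots> (\<zeta> ^ b)" by (rule trunc_eval_exp_of_nat_PI)
  also have "\<zeta> ^ b = \<zeta> powi a"
  proof -
    have nz: "\<zeta> \<noteq> 0" using zeta_power p_gt_1 by (auto simp: power_0_left)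
    have "\<zeta> powi a = \<zeta> powi (int p * (a div int p) + int b)" by (simp add: b)
    also have "\<dots> = (\<zeta> powi int p) powi (a div int p) * \<zeta> powi int b"
      using nz by (subst power_int_add) (auto simp: power_int_mult)
    finally show ?thesis by (simp add: zeta_power)
  qed
  finally show ?thesis .
qed

section \<open>Evaluation of series at a \<pi> modulo p\<close>

lemma of_int_PI_power_pred_cong_0: "congr (of_nat p) ((of_int a * PI) ^ (p - 1)) 0"
  using congr_mult_left[OF PI_power_pred_cong_0, of "of_int a ^ (p - 1)"]
  by (auto simp: power_mult_distrib)

text \<open>As \<open>(a \<pi>) ^ (p - 1)\<close> is a multiple of \<open>p\<close>, truncated
  evaluation at \<open>a \<pi>\<close> with cutoff \<open>p - 1\<close> respects products and
  compositions of integral series modulo \<open>p\<close>.\<close>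

lemma trunc_eval_cong_p:
  assumes "congr ((of_int a * PI) ^ (p - 1)) u v"
  shows "congr (of_nat p) u v"
proof -
  obtain c where c: "c \<in> R" "(of_int a * PI) ^ (p - 1) = of_nat p * c"
    using of_int_PI_power_pred_cong_0[of a] by (auto elim!: congrE)
  show ?thesis using assms[unfolded c(2)] c(1) by (rule congr_modulus)
qed

text \<open>Division by \<open>X\<close> costs one degree: the cutoff falls from \<open>p\<close> to
  \<open>p - 1\<close>.\<close>

lemma integral_below_exp_quot: "integral_below (p - 1) exp_quot"
  using integral_below_exp p_gt_1 by (intro integral_below_shift) auto

text \<open>Integrality of \<open>B_k / k!\<close> for \<open>k < p - 1\<close> comes from inverting
  a series with constant term 1, without the theorem of von Staudt.\<close>

lemma integral_below_bern_fps: "integral_below (p - 1) bern_fps"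
  by (rule integral_below_inverse[OF exp_quot_bern_fps _ integral_below_exp_quot]) simp

lemma of_int_PI_power_p_cong_0:
  assumes "s \<in> R"
  shows "congr (of_nat p) ((of_int a * PI * s) ^ p) 0"
proof -
  obtain c where c: "c \<in> R" "(of_int a * PI) ^ (p - 1) = of_nat p * c"
    using of_int_PI_power_pred_cong_0[of a] by (auto elim!: congrE)
  have "(of_int a * PI) ^ p = (of_int a * PI) * (of_int a * PI) ^ (p - 1)"
    using p_gt_1 by (simp flip: power_Suc)
  then have "(of_int a * PI * s) ^ p = of_nat p * (c * (of_int a * PI) * s ^ p)"
    unfolding c by (simp only: power_mult_distrib mult_ac)
  then show ?thesis using c PI_mem assms
    by (auto intro!: congr_0_mult)
qed

text \<open>The value has the form \<open>1 + x * s\<close>, and Frobenius leaves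
  \<open>1 + (x * s) ^ p\<close> with \<open>x ^ p\<close> divisible by \<open>p\<close>. Hence only
  the residue of the order \<open>m\<close> modulo \<open>p\<close> matters.\<close>

lemma trunc_eval_bern_fps_power:
  assumes "p dvd q"
  shows "congr (of_nat p) (trunc_eval (p - 1) bern_fps (of_int a * PI) ^ q) 1"
proof -
  define x where "x = of_int a * PI"
  have x: "x \<in> R" using PI_mem by (auto simp: x_def)
  define N where "N = p - 2"
  have N: "p - 1 = Suc N" using p_gt_1 by (simp add: N_def)
  define s where "s = trunc_eval N (fps_shift 1 bern_fps) x"
  have s: "s \<in> R" unfolding s_def
    using integral_below_bern_fps x by (intro trunc_eval_mem integral_below_shift) (auto simp flip: N)
  have eq: "trunc_eval (p - 1) bern_fps x = 1 + x * s"
    unfolding N trunc_eval_Suc s_def by (simp only: bern_fps_nth_0 of_rat_1)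
  have "congr (of_nat p) (trunc_eval (p - 1) bern_fps x ^ p) (1 + (x * s) ^ p)"
    unfolding eq using x s by (intro frobenius_cong) auto
  also have "congr (of_nat p) \<dots> (1 + 0)"
    unfolding x_def using s by (intro congr_add of_int_PI_power_p_cong_0) auto
  finally have *: "congr (of_nat p) (trunc_eval (p - 1) bern_fps x ^ p) 1" by simp
  obtain k where k: "q = p * k" using assms by auto
  have "congr (of_nat p) ((trunc_eval (p - 1) bern_fps x ^ p) ^ k) (1 ^ k)"
    using * by (intro congr_power) auto
  then show ?thesis by (simp add: k power_mult x_def)
qed

section \<open>The power congruence with Bernoulli numbers of higher order\<close>

lemma of_rat_bernoulli_order:
  "of_rat (bernoulli_order m k) = (fact k * of_rat ((bern_fps ^ m) $ k) :: 'a)"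
  unfolding bernoulli_order_def of_rat_mult by (metis of_nat_fact of_rat_of_nat_eq)

lemma bernoulli_sum_eq:
  "(\<Sum>j=0..p-2. of_rat (bernoulli_order m j) * (of_int a * PI) ^ (n + j) / fact j)
     = (of_int a * PI) ^ n * trunc_eval (p - 1) (bern_fps ^ m) (of_int a * PI)"
proof -
  have "{0..p-2} = {..<p-1}" using p_gt_1 by auto
  then show ?thesis
    by (simp add: of_rat_bernoulli_order trunc_eval_def sum_distrib_left power_add mult_ac)
qed

text \<open>The truncated exponential is \<open>1 + x g(x)\<close>. The error
  \<open>p * PI * r\<close> can be divided by \<open>x = a * PI\<close> because \<open>a\<close> is
  a unit, and the quotient is still a multiple of \<open>p\<close>.\<close>

lemma zeta_powi_factor:
  assumes "\<not> int p dvd a"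
  obtains w where "\<zeta> powi a - 1 = of_int a * PI * w"
    "congr (of_nat p) w (trunc_eval (p - 1) exp_quot (of_int a * PI))"
proof -
  have u: "is_unit_in (of_int a)" using assms by (rule is_unit_in_of_int)
  obtain r where r: "r \<in> R"
    "\<zeta> powi a = trunc_eval p (fps_exp 1) (of_int a * PI) + of_nat p * PI * r"
    using congr_sym[OF trunc_eval_exp_of_int_PI] by (auto elim!: congrE)
  have "trunc_eval p (fps_exp 1) (of_int a * PI)
      = 1 + of_int a * PI * trunc_eval (p - 1) exp_quot (of_int a * PI)"
    using trunc_eval_Suc[of "p - 1" "fps_exp 1"] p_gt_1 by simp
  note eq = this
  have "\<zeta> powi a - 1 = of_int a * PI *
      (trunc_eval (p - 1) exp_quot (of_int a * PI) + of_nat p * (r * inverse (of_int a)))"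
    unfolding r(2) eq using is_unit_inD(2)[OF u] by (simp add: field_simps)
  moreover have "r * inverse (of_int a) \<in> R"
    using r(1) is_unit_inD(3)[OF u] by (rule mult_mem)
  ultimately show ?thesis by (blast intro: that congrI)
qed

text \<open>Serves the degenerate case of both final congruences, where \<open>p\<close> divides
  \<open>a\<close> and both sides vanish.\<close>

lemma of_int_power_PI_dvd:
  assumes "int p dvd a" "k \<le> n" "s \<in> R"
  shows "congr (of_nat p ^ k * PI ^ n) ((of_int a * PI) ^ n * s) 0"
proof -
  obtain c where c: "a = int p * c" using assms by auto
  have "of_int a ^ n = (of_nat p ^ k * (of_nat p ^ (n - k) * of_int c ^ n) :: 'a)"
    unfolding c using assms by (simp add: power_mult_distrib flip: power_add mult.assoc)
  then have "(of_int a * PI) ^ n * s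
      = of_nat p ^ k * PI ^ n * (of_nat p ^ (n - k) * of_int c ^ n * s)"
    by (simp add: power_mult_distrib)
  then show ?thesis using assms(3)
    by (simp only:) (intro congr_0_mult mult_mem power_mem of_nat_mem of_int_mem)
qed

lemma zeta_powi_dvd:
  assumes "int p dvd a"
  shows "\<zeta> powi a = 1"
  using assms zeta_power by (auto simp: power_int_mult)

text \<open>If \<open>p\<close> does not divide \<open>a\<close>, both sides contain
  \<open>x ^ n\<close>, and it remains to compare \<open>g ^ n\<close> with \<open>h ^ m\<close>
  modulo \<open>p\<close>, where \<open>g * h\<close> is congruent to 1.\<close>

theorem zeta_powi_power_bernoulli:
  assumes m: "int m mod int p = (- int n) mod int p"
  shows "congr (of_nat p * PI ^ n) ((\<zeta> powi a - 1) ^ n)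
    (\<Sum>j=0..p-2. of_rat (bernoulli_order m j) * (of_int a * PI) ^ (n + j) / fact j)"
  unfolding bernoulli_sum_eq
proof -
  define x where "x = of_int a * PI"
  define g where "g = trunc_eval (p - 1) exp_quot x"
  define h where "h = trunc_eval (p - 1) bern_fps x"
  have x: "x \<in> R" using PI_mem by (auto simp: x_def)
  have g: "g \<in> R" and h: "h \<in> R"
    using x integral_below_exp_quot integral_below_bern_fps
    by (auto simp: g_def h_def intro: trunc_eval_mem)
  have "int p dvd int m - - int n" using m by (simp only: mod_eq_dvd_iff)
  then have mn: "p dvd m + n" by (simp flip: of_nat_add)
  have hm: "congr (of_nat p) (trunc_eval (p - 1) (bern_fps ^ m) x) (h ^ m)"
    unfolding h_def x_def using PI_mem p_gt_1 integral_below_bern_fps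
    by (intro trunc_eval_cong_p[of a] trunc_eval_power) auto
  have "congr (of_nat p) (trunc_eval (p - 1) (exp_quot * bern_fps) x) (g * h)"
    unfolding g_def h_def x_def using PI_mem integral_below_bern_fps integral_below_exp_quot
    by (intro trunc_eval_cong_p[of a] trunc_eval_mult) auto
  then have gh: "congr (of_nat p) (g * h) 1"
    unfolding exp_quot_bern_fps using p_gt_1 by (simp add: trunc_eval_1 congr_sym)
  \<comment> \<open>Inserting \<open>(g * h) ^ n\<close> turns \<open>h ^ m\<close> into
    \<open>g ^ n * h ^ (m + n)\<close>, whose last factor is trivial as \<open>p\<close> divides
    \<open>m + n\<close>.\<close>
  have "congr (of_nat p) (h ^ m * (g * h) ^ n) (h ^ m * 1 ^ n)"
    using gh h by (intro congr_mult_left congr_power) auto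
  then have "congr (of_nat p) (h ^ m) (h ^ m * (g * h) ^ n)" by (simp add: congr_sym)
  also have "h ^ m * (g * h) ^ n = g ^ n * h ^ (m + n)"
    by (simp add: power_add power_mult_distrib mult_ac)
  also have "congr (of_nat p) \<dots> (g ^ n * 1)"
    unfolding h_def x_def using g mn by (intro congr_mult_left trunc_eval_bern_fps_power) auto
  finally have B: "congr (of_nat p) (trunc_eval (p - 1) (bern_fps ^ m) x) (g ^ n)"
    using hm by (auto intro: congr_trans)
  show "congr (of_nat p * PI ^ n) ((\<zeta> powi a - 1) ^ n)
      ((of_int a * PI) ^ n * trunc_eval (p - 1) (bern_fps ^ m) (of_int a * PI))"
  \<comment> \<open>For \<open>n = 0\<close> both powers are 1 even if
    \<open>\<zeta> powi a - 1\<close> vanishes, so this case does not belong to the degenerate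
    one.\<close>
  proof (cases "int p dvd a \<and> n > 0")
    case True
    have "congr (of_nat p ^ 1 * PI ^ n) (x ^ n * trunc_eval (p - 1) (bern_fps ^ m) x) 0"
      unfolding x_def using True PI_mem integral_below_bern_fps
      by (intro of_int_power_PI_dvd trunc_eval_mem integral_below_power) auto
    then show ?thesis using True
      by (simp add: zeta_powi_dvd power_0_left x_def congr_sym)
  next
    case False
    have "\<exists>w. (\<zeta> powi a - 1) ^ n = (x * w) ^ n \<and> congr (of_nat p) (w ^ n) (g ^ n)"
    proof (cases "n = 0")
      case False
      with \<open>\<not> (int p dvd a \<and> n > 0)\<close> have "\<not> int p dvd a" by simp
      from zeta_powi_factor[OF this] obtain w where w: "\<zeta> powi a - 1 = x * w" "congr (of_nat p) w g"
        unfolding x_def g_def by blast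
      then show ?thesis using g by (intro exI[of _ w]) (auto intro!: congr_power)
    qed auto
    then obtain w where w: "(\<zeta> powi a - 1) ^ n = (x * w) ^ n" "congr (of_nat p) (w ^ n) (g ^ n)"
      by blast
    have "congr (of_nat p) (w ^ n) (trunc_eval (p - 1) (bern_fps ^ m) x)"
      using w(2) B by (blast intro: congr_trans congr_sym)
    then have "congr (x ^ n * of_nat p) (x ^ n * w ^ n) (x ^ n * trunc_eval (p - 1) (bern_fps ^ m) x)"
      by (rule congr_scale)
    moreover have "x ^ n * of_nat p = of_nat p * PI ^ n * of_int a ^ n"
      by (simp add: x_def power_mult_distrib)
    ultimately have "congr (of_nat p * PI ^ n) (x ^ n * w ^ n)
        (x ^ n * trunc_eval (p - 1) (bern_fps ^ m) x)"
      by (metis congr_modulus of_int_mem power_mem)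
    then show ?thesis by (simp add: w(1) power_mult_distrib flip: x_def)
  qed
qed

text \<open>The series of \<open>ln ((e^x - 1) / x)\<close> truncated below degree
  \<open>p - 1\<close>, without its linear term \<open>x / 2\<close>. The range is empty for
  \<open>p <= 3\<close>.\<close>

definition bernoulli_log :: "'a \<Rightarrow> 'a" where
  "bernoulli_log x = (\<Sum>k\<in>{1<..<p-1}. of_rat (bernoulli k) / (fact k * of_nat k) * x ^ k)"

lemma bernoulli_log_mem:
  assumes "x \<in> R"
  shows "bernoulli_log x \<in> R"
  unfolding bernoulli_log_def
proof (rule sum_mem)
  fix k assume k: "k \<in> {1<..<p-1}"
  then have "of_rat (bern_fps $ k) \<in> R" using integral_below_bern_fps by (auto simp: integral_below_def)
  then have "of_rat (bern_fps $ k) / of_nat k * x ^ k \<in> R"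
    using k assms by (intro mult_mem divide_of_nat_mem power_mem) auto
  then show "of_rat (bernoulli k) / (fact k * of_nat k) * x ^ k \<in> R"
    unfolding of_rat_bernoulli_order power_one_right by simp
qed

lemma trunc_eval_ln_compose_exp_quot:
  assumes "p > 2"
  shows "trunc_eval (p - 1) (fps_ln 1 oo (exp_quot - 1)) x = x / 2 + bernoulli_log x"
proof -
  define L where "L = fps_ln 1 oo (exp_quot - 1)"
  have L0: "L $ 0 = 0" by (simp add: L_def)
  \<comment> \<open>The value is \<open>1 + B_1\<close> with \<open>B_1 = - 1 / 2\<close>; the 1 is
    the extra term in degree 1.\<close>
  have L1: "L $ 1 = 1 / 2"
    using ln_compose_exp_quot_nth[of 1] by (simp add: L_def bern_fps_nth_1 del: One_nat_def)
  have Lk: "of_rat (L $ k) = (of_rat (bernoulli k) / (fact k * of_nat k) :: 'a)" if "k > 1" for k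
  proof -
    have "of_nat k * L $ k = bern_fps $ k"
      using ln_compose_exp_quot_nth[of k] that by (simp add: L_def)
    then have "L $ k = bern_fps $ k / of_nat k" using that by (simp add: field_simps)
    then show ?thesis unfolding of_rat_bernoulli_order power_one_right by (simp add: of_rat_divide)
  qed
  have set: "{..<p-1} = insert 0 (insert 1 {1<..<p-1})" using assms by auto
  have "trunc_eval (p - 1) L x
      = of_rat (L $ 0) * x ^ 0 + (of_rat (L $ 1) * x ^ 1 + (\<Sum>k\<in>{1<..<p-1}. of_rat (L $ k) * x ^ k))"
    unfolding trunc_eval_def set by (subst sum.insert; simp)+
  also have "(\<Sum>k\<in>{1<..<p-1}. of_rat (L $ k) * x ^ k) = bernoulli_log x"
    unfolding bernoulli_log_def by (intro sum.cong) (auto simp: Lk)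
  finally show ?thesis
    unfolding L0 L1 by (simp add: L_def of_rat_divide)
qed

section \<open>The p-th power of (e^x - 1) / x modulo the square of p\<close>

lemma of_int_PI_power_pred:
  assumes "\<not> int p dvd a"
  shows "congr (of_nat p ^ 2) ((of_int a * PI) ^ (p - 1)) (- of_nat p)"
proof -
  have "(of_int a * PI) ^ (p - 1) = of_int a ^ (p - 1) * PI ^ (p - 1)"
    by (rule power_mult_distrib)
  also have "congr (of_nat p ^ 2) \<dots> (of_int a ^ (p - 1) * - of_nat p)"
    by (intro congr_mult_left PI_power_pred) auto
  also have "of_int a ^ (p - 1) * - of_nat p = - (of_nat p * of_int a ^ (p - 1) :: 'a)"
    by simp
  also have "congr (of_nat p ^ 2) \<dots> (- (of_nat p * 1))"
    by (intro congr_uminus congr_p_scale fermat_cong_unit assms)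
  finally show ?thesis by simp
qed

text \<open>The linear term \<open>x / 2\<close> of \<open>ln ((e\<^sup>x - 1) / x)\<close> is cancelled by the
  contribution \<open>Y\<^sup>p\<close> of the binomial expansion, because \<open>x\<^sup>p\<close> is \<open>- p x\<close> modulo \<open>p\<^sup>2\<close>.\<close>

lemma trunc_eval_exp_quot_power_p:
  assumes p: "p > 2" and a: "\<not> int p dvd a"
  defines "x \<equiv> of_int a * PI"
  shows "congr (of_nat p ^ 2) (trunc_eval (p - 1) exp_quot x ^ p) (1 + of_nat p * bernoulli_log x)"
proof -
  have x: "x \<in> R" using PI_mem by (auto simp: x_def)
  define N where "N = p - 3"
  have N: "p - 1 = Suc (Suc N)" using p by (simp add: N_def)
  have ie: "integral_below (p - 1) (exp_quot - 1)"
    by (intro integral_below_diff integral_below_exp_quot integral_below_1)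
  define s where "s = trunc_eval N (fps_shift 1 (fps_shift 1 (exp_quot - 1))) x"
  have s: "s \<in> R" unfolding s_def
    using ie x by (intro trunc_eval_mem integral_below_shift) (simp_all flip: N)
  have half: "1 / 2 \<in> R" using divide_of_nat_mem[of 1 2] p by simp
  \<comment> \<open>The coefficient of \<open>x\<close> in \<open>(e^x - 1) / x - 1\<close> is
    \<open>1 / 2\<close>; \<open>v\<close> is the quotient of \<open>Y\<close> by
    \<open>x\<close>.\<close>
  define v where "v = 1 / 2 + x * s"
  have v: "v \<in> R" unfolding v_def using half x s by blast
  define Y where "Y = trunc_eval (p - 1) (exp_quot - 1) x"
  have Yv: "Y = x * v"
    unfolding Y_def N trunc_eval_Suc v_def s_def by (simp add: numeral_2_eq_2 of_rat_divide)
  have Y: "Y \<in> R" unfolding Yv using x v by blast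
  have gY: "trunc_eval (p - 1) exp_quot x = 1 + Y"
    unfolding Y_def trunc_eval_diff using p by (simp add: trunc_eval_1)
  have 1: "congr (of_nat p ^ 2) ((1 + Y) ^ p) (1 + of_nat p * trunc_eval p (fps_ln 1) Y + Y ^ p)"
    using one_plus_power_p[OF Y] Y by (rule congr_modulus)
  have 2: "congr (of_nat p) (trunc_eval p (fps_ln 1) Y) (x / 2 + bernoulli_log x)"
  proof -
    \<comment> \<open>The binomial congruence cuts the logarithm at \<open>p\<close>, the
      composition needs the cutoff \<open>p - 1\<close>. The term in between carries
      \<open>x ^ (p - 1)\<close> and vanishes modulo \<open>p\<close>.\<close>
    have "trunc_eval p (fps_ln 1) Y
        = trunc_eval (p - 1) (fps_ln 1) Y + of_rat (fps_ln 1 $ (p - 1)) * Y ^ (p - 1)"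
      using trunc_eval_def p by (cases p) auto
    also have "Y ^ (p - 1) = v ^ (p - 1) * x ^ (p - 1)"
      unfolding Yv by (simp add: power_mult_distrib)
    also have "congr (of_nat p) (trunc_eval (p - 1) (fps_ln 1) Y
          + of_rat (fps_ln 1 $ (p - 1)) * (v ^ (p - 1) * x ^ (p - 1)))
        (trunc_eval (p - 1) (fps_ln 1) Y + of_rat (fps_ln 1 $ (p - 1)) * (v ^ (p - 1) * 0))"
      unfolding x_def using integral_below_ln p v
      by (intro congr_add congr_refl congr_mult_left of_int_PI_power_pred_cong_0)
        (auto simp: integral_below_def)
    also have "\<dots> = trunc_eval (p - 1) (fps_ln 1) Y" by simp
    also have "congr (of_nat p) \<dots> (trunc_eval (p - 1) (fps_ln 1 oo (exp_quot - 1)) x)"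
      unfolding Y_def x_def
      by (rule trunc_eval_cong_p[of a], rule congr_sym, rule trunc_eval_compose)
         (use ie PI_mem integral_below_ln in \<open>auto intro: integral_below_mono\<close>)
    also have "\<dots> = x / 2 + bernoulli_log x" using p by (rule trunc_eval_ln_compose_exp_quot)
    finally show ?thesis .
  qed
  have 3: "congr (of_nat p) (v ^ p) (1 / 2)"
  proof -
    \<comment> \<open>Frobenius applies to \<open>2 * v\<close>, which has constant term 1; Fermat
      then replaces \<open>2 ^ p\<close> by 2.\<close>
    have "2 * v = 1 + x * (2 * s)" by (simp add: v_def distrib_left)
    then have "congr (of_nat p) ((2 * v) ^ p) (1 + (x * (2 * s)) ^ p)"
      using x s by (auto intro!: frobenius_cong mult_mem simp: of_nat_mem[of 2, simplified])
    also have "congr (of_nat p) \<dots> (1 + 0)"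
      unfolding x_def using s of_nat_mem[of 2]
      by (intro congr_add congr_refl of_int_PI_power_p_cong_0 mult_mem) auto
    finally have A: "congr (of_nat p) (2 ^ p * v ^ p) 1" by (simp add: power_mult_distrib)
    have "congr (of_nat p) (v ^ p * 2) (v ^ p * 2 ^ p)"
      using fermat_cong[of 2] v by (intro congr_mult_left) (auto intro: congr_sym)
    then have "congr (of_nat p) (v ^ p * 2) 1"
      using A by (auto intro: congr_trans simp: mult.commute)
    from congr_mult_left[OF this half] show ?thesis by simp
  qed
  have 4: "congr (of_nat p ^ 2) (Y ^ p) (- (of_nat p * (x / 2)))"
  proof -
    \<comment> \<open>Since \<open>x ^ (p - 1)\<close> supplies a factor \<open>p\<close>, the value
      of \<open>v ^ p\<close> matters only modulo \<open>p\<close>.\<close>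
    have "x ^ p = x ^ (p - 1) * x" using p by (simp flip: power_Suc2)
    then have "Y ^ p = (x * v ^ p) * x ^ (p - 1)"
      unfolding Yv power_mult_distrib by (simp only: mult_ac)
    also have "congr (of_nat p ^ 2) \<dots> ((x * v ^ p) * - of_nat p)"
      using x v of_int_PI_power_pred[OF a] unfolding x_def by (intro congr_mult_left) auto
    also have "(x * v ^ p) * - of_nat p = - (of_nat p * (x * v ^ p))" by simp
    also have "congr (of_nat p ^ 2) \<dots> (- (of_nat p * (x * (1 / 2))))"
      using 3 x by (intro congr_uminus congr_p_scale congr_mult_left)
    finally show ?thesis by simp
  qed
  have "congr (of_nat p ^ 2) (trunc_eval (p - 1) exp_quot x ^ p)
      (1 + of_nat p * trunc_eval p (fps_ln 1) Y + Y ^ p)"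
    unfolding gY by (rule 1)
  also have "congr (of_nat p ^ 2) \<dots>
      (1 + of_nat p * (x / 2 + bernoulli_log x) + - (of_nat p * (x / 2)))"
    using 2 4 by (intro congr_add congr_refl congr_p_scale)
  also have "\<dots> = 1 + of_nat p * bernoulli_log x" by (simp add: distrib_left)
  finally show ?thesis .
qed

text \<open>For \<open>W = 1 + Y\<close> the term \<open>p * Y\<close> gives the linear part; the
  quadratic error carries \<open>p ^ (2 * b + 1)\<close> and \<open>Y ^ p\<close> carries
  \<open>p ^ (b * p)\<close>. For \<open>p = 2\<close> and \<open>b = 1\<close> the latter is too
  weak, which is why \<open>S = 0\<close> is assumed there.\<close>

lemma power_p_cong_lift:
  assumes S: "S \<in> R" and b: "b > 0" and p2: "p = 2 \<Longrightarrow> S = 0"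
    and W: "congr (of_nat p ^ (b + 1)) W (1 + of_nat p ^ b * S)"
  shows "congr (of_nat p ^ (b + 2)) (W ^ p) (1 + of_nat p ^ (b + 1) * S)"
proof -
  obtain r where r: "r \<in> R" "W = 1 + of_nat p ^ b * S + of_nat p ^ (b + 1) * r"
    using W by (auto elim!: congrE)
  define Z where "Z = S + of_nat p * r"
  define Y where "Y = of_nat p ^ b * Z"
  have Z: "Z \<in> R" using S r by (auto simp: Z_def)
  then have Y: "Y \<in> R" by (auto simp: Y_def)
  have WY: "W = 1 + Y" by (simp add: r(2) Y_def Z_def algebra_simps)
  obtain s where s: "s \<in> R" "trunc_eval p (fps_ln 1) Y = Y * (1 + Y * s)"
    using trunc_eval_ln_factor[OF Y] by auto
  have low: "congr (of_nat p ^ (b + 2)) (of_nat p ^ k * c) 0" if "b + 2 \<le> k" "c \<in> R" for k c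
  proof -
    have "k = (b + 2) + (k - (b + 2))" using that by simp
    then have "of_nat p ^ k * c = of_nat p ^ (b + 2) * (of_nat p ^ (k - (b + 2)) * c)"
      by (metis power_add mult.assoc)
    then show ?thesis using that(2)
      by (simp only:) (intro congr_0_mult mult_mem power_mem of_nat_mem)
  qed
  \<comment> \<open>Here the factor \<open>Y\<close> of the modulus raises the precision from
    \<open>p^2\<close> to \<open>p ^ (b + 2)\<close>.\<close>
  have modulus: "of_nat p ^ 2 * Y = of_nat p ^ (b + 2) * Z"
    by (simp add: Y_def power_add power2_eq_square mult_ac)
  have "congr (of_nat p ^ (b + 2)) (W ^ p) (1 + of_nat p * trunc_eval p (fps_ln 1) Y + Y ^ p)"
    unfolding WY using one_plus_power_p[OF Y, unfolded modulus] Z by (rule congr_modulus)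
  also have "of_nat p * trunc_eval p (fps_ln 1) Y
      = of_nat p ^ (b + 1) * S + (of_nat p ^ (b + 2) * r + of_nat p ^ (2 * b + 1) * (Z ^ 2 * s))"
  proof -
    have "of_nat p * (Y * (1 + Y * s)) = of_nat p * (of_nat p ^ b * Z)
        + of_nat p * (of_nat p ^ b * of_nat p ^ b) * (Z ^ 2 * s)"
      by (simp add: Y_def power2_eq_square algebra_simps)
    also have "of_nat p * (of_nat p ^ b * of_nat p ^ b) = (of_nat p ^ (2 * b + 1) :: 'a)"
      by (simp add: power_mult power2_eq_square power_mult_distrib mult.commute)
    also have "of_nat p * (of_nat p ^ b * Z) = of_nat p ^ (b + 1) * S + of_nat p ^ (b + 2) * r"
      by (simp add: Z_def algebra_simps)
    finally show ?thesis unfolding s(2) by (simp only: add.assoc)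
  qed
  also have "congr (of_nat p ^ (b + 2)) (1 + (of_nat p ^ (b + 1) * S
      + (of_nat p ^ (b + 2) * r + of_nat p ^ (2 * b + 1) * (Z ^ 2 * s))) + Y ^ p)
      (1 + (of_nat p ^ (b + 1) * S + (0 + 0)) + 0)"
  proof (intro congr_add congr_refl low)
    show "congr (of_nat p ^ (b + 2)) (Y ^ p) 0"
    proof (cases "p = 2")
      case True
      then have "Y = of_nat p ^ (b + 1) * r"
        using p2 by (simp add: Y_def Z_def)
      then have eq: "Y ^ p = of_nat p ^ ((b + 1) * p) * r ^ p"
        by (simp only: power_mult_distrib power_mult)
      have "b + 2 \<le> (b + 1) * p" using True by simp
      then show ?thesis unfolding eq using r(1) by (intro low power_mem)
    next
      case False
      then have "b * 3 \<le> b * p" using p_gt_1 by (intro mult_le_mono) auto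
      then have "b + 2 \<le> b * p" using b by linarith
      moreover have eq: "Y ^ p = of_nat p ^ (b * p) * Z ^ p"
        by (simp add: Y_def power_mult_distrib power_mult)
      ultimately show ?thesis unfolding eq using Z by (intro low power_mem)
    qed
  qed (use r Z s b in auto)
  finally show ?thesis by simp
qed

text \<open>Quadratic terms carry \<open>p ^ (2 * b)\<close>, and
  \<open>2 * b >= b + 1\<close>.\<close>

lemma one_plus_p_power_cong:
  assumes S: "S \<in> R" and b: "b > 0"
  shows "congr (of_nat p ^ (b + 1)) ((1 + of_nat p ^ b * S) ^ n) (1 + of_nat (p ^ b * n) * S)"
proof (induction n)
  case (Suc n)
  have "(1 + of_nat p ^ b * S) ^ Suc n = (1 + of_nat p ^ b * S) * (1 + of_nat p ^ b * S) ^ n"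
    by simp
  also have "congr (of_nat p ^ (b + 1)) \<dots> ((1 + of_nat p ^ b * S) * (1 + of_nat (p ^ b * n) * S))"
    using S Suc by (intro congr_mult_left) auto
  also have "\<dots> = (1 + of_nat (p ^ b * Suc n) * S) + of_nat p ^ (b + b) * (of_nat n * S ^ 2)"
    by (simp add: power2_eq_square power_add algebra_simps)
  also have "b + b = (b + 1) + (b - 1)" using b by simp
  also have "(1 + of_nat (p ^ b * Suc n) * S)
      + of_nat p ^ ((b + 1) + (b - 1)) * (of_nat n * S ^ 2)
    = (1 + of_nat (p ^ b * Suc n) * S)
      + of_nat p ^ (b + 1) * (of_nat p ^ (b - 1) * (of_nat n * S ^ 2))"
    by (simp only: power_add mult.assoc)
  also have "congr (of_nat p ^ (b + 1)) \<dots> (1 + of_nat (p ^ b * Suc n) * S + 0)"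
    using S by (intro congr_add congr_refl congr_0_mult) auto
  finally show ?case by simp
qed auto

text \<open>Modulo \<open>p^2\<close> the power \<open>w ^ p\<close> depends only on
  \<open>w\<close> modulo \<open>p\<close>, which settles \<open>b = 1\<close>; each further
  \<open>p\<close>-th power raises the precision by one.\<close>

lemma zeta_powi_quotient_power:
  assumes b: "b > 0" and a: "\<not> int p dvd a"
  defines "x \<equiv> of_int a * PI"
  assumes w: "congr (of_nat p) w (trunc_eval (p - 1) exp_quot x)"
  shows "congr (of_nat p ^ (b + 1)) (w ^ (p ^ b)) (1 + of_nat p ^ b * bernoulli_log x)"
proof -
  have x: "x \<in> R" using PI_mem by (auto simp: x_def)
  have S: "bernoulli_log x \<in> R" using x by (rule bernoulli_log_mem)
  have p2: "bernoulli_log x = 0" if "p = 2"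
    unfolding bernoulli_log_def using that by simp
  have "b \<ge> 1" using b by simp
  then show ?thesis
  proof (induction b rule: nat_induct_at_least)
    case base
    have "congr (of_nat p ^ 2) (w ^ p) (trunc_eval (p - 1) exp_quot x ^ p)"
      using w x integral_below_exp_quot by (intro congr_power_p trunc_eval_mem)
    also have "congr (of_nat p ^ 2) \<dots> (1 + of_nat p * bernoulli_log x)"
    proof (cases "p = 2")
      case True
      then have "trunc_eval (p - 1) exp_quot x = 1" by (simp add: trunc_eval_def)
      then show ?thesis using True p2 by simp
    next
      case False
      then show ?thesis
        unfolding x_def using p_gt_1 a by (intro trunc_eval_exp_quot_power_p) auto
    qed
    finally show ?case by (simp add: power2_eq_square)
  next
    case (Suc b)
    then have "congr (of_nat p ^ (b + 2)) ((w ^ (p ^ b)) ^ p) (1 + of_nat p ^ (b + 1) * bernoulli_log x)"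
      using S p2 by (intro power_p_cong_lift) auto
    then show ?case by (simp add: power_mult[symmetric] mult.commute)
  qed
qed

lemma bernoulli_log_sum_eq:
  "(\<Sum>k\<in>{1<..<p-1}. of_rat (bernoulli k) / (fact k * of_nat k) * x ^ (N + k))
     = x ^ N * bernoulli_log x"
  by (simp add: bernoulli_log_def sum_distrib_left power_add mult_ac)

text \<open>With \<open>\<zeta> powi a - 1 = x * w\<close>, the congruence for
  \<open>w ^ (p ^ b)\<close> is raised to the \<open>n\<close>-th power, linearised and multiplied
  by \<open>x ^ N\<close>.\<close>

theorem zeta_powi_power_p_power:
  assumes b: "b > 0"
  shows "congr (of_nat p ^ (b + 1) * PI ^ (p ^ b * n)) ((\<zeta> powi a - 1) ^ (p ^ b * n))
    ((of_int a * PI) ^ (p ^ b * n) + of_nat (p ^ b * n) *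
       (\<Sum>k\<in>{1<..<p-1}. of_rat (bernoulli k) / (fact k * of_nat k)
          * (of_int a * PI) ^ (p ^ b * n + k)))"
proof -
  define x where "x = of_int a * PI"
  define N where "N = p ^ b * n"
  have x: "x \<in> R" using PI_mem by (auto simp: x_def)
  have S: "bernoulli_log x \<in> R" using x by (rule bernoulli_log_mem)
  have rhs: "x ^ N + of_nat N * (x ^ N * bernoulli_log x) = x ^ N * (1 + of_nat N * bernoulli_log x)"
    by (simp add: algebra_simps)
  have "congr (of_nat p ^ (b + 1) * PI ^ N) ((\<zeta> powi a - 1) ^ N)
      (x ^ N * (1 + of_nat N * bernoulli_log x))"
  proof (cases "int p dvd a \<and> n > 0")
    case True
    \<comment> \<open>This provides the \<open>b + 1\<close> factors \<open>p\<close> that make both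
      sides vanish when \<open>p\<close> divides \<open>a\<close>.\<close>
    have "b < p ^ b" using p_gt_1 by (simp add: power_gt_expt)
    also have "p ^ b * 1 \<le> p ^ b * n" using True by (intro mult_le_mono) auto
    finally have bN: "b + 1 \<le> N" by (simp add: N_def)
    then have "congr (of_nat p ^ (b + 1) * PI ^ N) (x ^ N * (1 + of_nat N * bernoulli_log x)) 0"
      unfolding x_def using True S[unfolded x_def] by (intro of_int_power_PI_dvd) auto
    then show ?thesis using True bN by (simp add: zeta_powi_dvd power_0_left congr_sym)
  next
    case False
    show ?thesis
    proof (cases "n = 0")
      case True
      then show ?thesis by (simp add: N_def)
    next
      case n: False
      with False have a: "\<not> int p dvd a" by simp
      obtain w where w: "\<zeta> powi a - 1 = x * w" "congr (of_nat p) w (trunc_eval (p - 1) exp_quot x)"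
        using zeta_powi_factor[OF a] unfolding x_def by blast
      have "congr (of_nat p ^ (b + 1)) ((w ^ (p ^ b)) ^ n) ((1 + of_nat p ^ b * bernoulli_log x) ^ n)"
        using S zeta_powi_quotient_power[OF b a w(2)[unfolded x_def]] unfolding x_def
        by (intro congr_power) auto
      also have "congr (of_nat p ^ (b + 1)) \<dots> (1 + of_nat (p ^ b * n) * bernoulli_log x)"
        using S b by (rule one_plus_p_power_cong)
      finally have "congr (of_nat p ^ (b + 1)) (w ^ N) (1 + of_nat N * bernoulli_log x)"
        by (simp add: N_def power_mult)
      then have "congr (x ^ N * of_nat p ^ (b + 1)) (x ^ N * w ^ N)
          (x ^ N * (1 + of_nat N * bernoulli_log x))"
        by (rule congr_scale)
      moreover have "x ^ N * of_nat p ^ (b + 1) = of_nat p ^ (b + 1) * PI ^ N * of_int a ^ N"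
        by (simp add: x_def power_mult_distrib)
      ultimately have "congr (of_nat p ^ (b + 1) * PI ^ N) (x ^ N * w ^ N)
          (x ^ N * (1 + of_nat N * bernoulli_log x))"
        by (metis congr_modulus of_int_mem power_mem)
      then show ?thesis by (simp add: w(1) power_mult_distrib)
    qed
  qed
  then show ?thesis
    unfolding bernoulli_log_sum_eq by (simp only: rhs flip: x_def N_def)
qed

end


section \<open>The ring $\mathbb{Z}_p[\zeta]$\<close>

text \<open>The inverse is the geometric series in \<open>e = - p c\<close>. Its residue modulo
  \<open>p ^ n\<close> is that of the partial sum with \<open>n\<close> terms, since
  \<open>e ^ n\<close> vanishes there.\<close>

lemma padic_int_one_plus_p_invertible:
  fixes c :: "'p :: prime_card padic_int"
  shows "\<exists>d. (1 + of_nat CARD('p) * c) * d = 1"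
proof -
  let ?q = "int CARD('p)"
  define e where "e = - (of_nat CARD('p) * c)"
  define G where "G = (\<lambda>n. \<Sum>i<n. e ^ i)"
  have Rep_e: "Rep_padic_int (e ^ n * y) n = 0" for n and y :: "'p padic_int"
  proof -
    have "e ^ n * y = of_nat (CARD('p) ^ n) * ((- c) ^ n * y)"
      by (simp add: e_def power_mult_distrib mult.assoc flip: mult_minus_right)
    then show ?thesis
      by (simp only: times_padic_int.rep_eq Rep_padic_int_of_nat) simp
  qed
  have Rep_add: "Rep_padic_int (u + v) n = Rep_padic_int u n"
    if "Rep_padic_int v n = 0" for u v :: "'p padic_int" and n
    using that padic_int_residue_mod[of n n u] by (simp add: plus_padic_int.rep_eq)
  define d :: "'p padic_int" where "d = Abs_padic_int (\<lambda>n. Rep_padic_int (G n) n)"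
  have Rep_d: "Rep_padic_int d n = Rep_padic_int (G n) n" for n
  proof -
    \<comment> \<open>Consecutive partial sums differ by \<open>e ^ k\<close>, so their residues are
      compatible and define an element of \<open>\<int>\<^sub>p\<close>.\<close>
    have "Rep_padic_int (G (Suc k)) (Suc k) mod ?q ^ k = Rep_padic_int (G k) k" for k
    proof -
      have "Rep_padic_int (G (Suc k)) (Suc k) mod ?q ^ k = Rep_padic_int (G (Suc k)) k"
        by (rule padic_int_residue_mod) simp
      also have "\<dots> = Rep_padic_int (G k) k"
        using Rep_add[OF Rep_e[of k 1]] by (simp add: G_def)
      finally show ?thesis .
    qed
    then show ?thesis unfolding d_def by (subst Abs_padic_int_inverse) auto
  qed
  have "Rep_padic_int ((1 - e) * d) n = Rep_padic_int (1 :: 'p padic_int) n" for n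
  proof -
    have "Rep_padic_int ((1 - e) * d) n = Rep_padic_int ((1 - e) * G n) n"
      by (simp add: times_padic_int.rep_eq Rep_d)
    also have "(1 - e) * G n = 1 - e ^ n"
      unfolding G_def by (rule one_diff_power_eq[symmetric])
    also have "1 - e ^ n = 1 + e ^ n * (- 1)" by simp
    also have "Rep_padic_int \<dots> n = Rep_padic_int (1 :: 'p padic_int) n"
      by (intro Rep_add Rep_e)
    finally show ?thesis .
  qed
  then have "(1 - e) * d = 1" by (simp add: Rep_padic_int_inject[symmetric] fun_eq_iff)
  then show ?thesis by (auto simp: e_def)
qed

section \<open>Ring structure of the set of polynomial values at \<zeta>\<close>

lemma padic_int_to_ac_hom [simp]:
  "padic_int_to_ac 0 = 0" "padic_int_to_ac 1 = 1"
  "padic_int_to_ac (x + y) = padic_int_to_ac x + padic_int_to_ac y"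
  "padic_int_to_ac (x * y) = padic_int_to_ac x * padic_int_to_ac y"
  "padic_int_to_ac (- x) = - padic_int_to_ac x"
  "padic_int_to_ac (x - y) = padic_int_to_ac x - padic_int_to_ac y"
  by (simp_all add: padic_int_to_ac_def flip: to_ac_add to_ac_mult to_ac_minus to_ac_diff
        Zero_fract_def One_fract_def)

lemma padic_int_to_ac_of_nat [simp]: "padic_int_to_ac (of_nat n) = of_nat n"
  by (induction n) auto

lemma padic_int_adjoinI:
  "x = poly (map_poly padic_int_to_ac f) \<zeta> \<Longrightarrow> x \<in> padic_int_adjoin \<zeta>"
  by (auto simp: padic_int_adjoin_def)

lemma eval_hom:
  "poly (map_poly padic_int_to_ac (f + g)) \<zeta>
     = poly (map_poly padic_int_to_ac f) \<zeta> + poly (map_poly padic_int_to_ac g) \<zeta>"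
  "poly (map_poly padic_int_to_ac (smult c f)) \<zeta>
     = padic_int_to_ac c * poly (map_poly padic_int_to_ac f) \<zeta>"
  "poly (map_poly padic_int_to_ac (- f)) \<zeta> = - poly (map_poly padic_int_to_ac f) \<zeta>"
proof -
  have "map_poly padic_int_to_ac (f + g) = map_poly padic_int_to_ac f + map_poly padic_int_to_ac g"
    by (rule poly_eqI) (simp add: coeff_map_poly)
  then show "poly (map_poly padic_int_to_ac (f + g)) \<zeta>
     = poly (map_poly padic_int_to_ac f) \<zeta> + poly (map_poly padic_int_to_ac g) \<zeta>" by simp
  have "map_poly padic_int_to_ac (- f) = - map_poly padic_int_to_ac f"
    by (rule poly_eqI) (simp add: coeff_map_poly)
  then show "poly (map_poly padic_int_to_ac (- f)) \<zeta> = - poly (map_poly padic_int_to_ac f) \<zeta>"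
    by simp
qed (simp add: map_poly_smult)

lemma eval_mult:
  "poly (map_poly padic_int_to_ac (f * g)) \<zeta>
     = poly (map_poly padic_int_to_ac f) \<zeta> * poly (map_poly padic_int_to_ac g) \<zeta>"
  by (induction f) (simp_all add: map_poly_pCons eval_hom algebra_simps)

lemma padic_int_adjoin_const: "padic_int_to_ac c \<in> padic_int_adjoin \<zeta>"
  by (rule padic_int_adjoinI[of _ "[:c:]"]) (simp add: map_poly_pCons)

lemma padic_int_adjoin_root: "\<zeta> \<in> padic_int_adjoin \<zeta>"
  by (rule padic_int_adjoinI[of _ "[:0, 1:]"]) (simp add: map_poly_pCons)

lemma padic_int_adjoin_diff:
  "a \<in> padic_int_adjoin \<zeta> \<Longrightarrow> b \<in> padic_int_adjoin \<zeta> \<Longrightarrow> a - b \<in> padic_int_adjoin \<zeta>"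
  unfolding padic_int_adjoin_def
  by (auto simp: image_iff simp flip: eval_hom add_uminus_conv_diff)

lemma padic_int_adjoin_mult:
  "a \<in> padic_int_adjoin \<zeta> \<Longrightarrow> b \<in> padic_int_adjoin \<zeta> \<Longrightarrow> a * b \<in> padic_int_adjoin \<zeta>"
  unfolding padic_int_adjoin_def by (auto simp: image_iff simp flip: eval_mult)

lemma padic_int_adjoin_power:
  "a \<in> padic_int_adjoin \<zeta> \<Longrightarrow> a ^ n \<in> padic_int_adjoin \<zeta>"
  using padic_int_adjoin_const[of 1] by (induction n) (auto intro: padic_int_adjoin_mult)

lemma padic_int_adjoin_add:
  assumes "a \<in> padic_int_adjoin \<zeta>" "b \<in> padic_int_adjoin \<zeta>"
  shows "a + b \<in> padic_int_adjoin \<zeta>"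
  using padic_int_adjoin_diff[OF assms(1) padic_int_adjoin_diff[OF padic_int_adjoin_const[of 0] assms(2)]]
  by simp

text \<open>Horner's scheme: multiplication by \<zeta> shifts the coefficients, and the top one
  wraps around to the constant term because \<open>\<zeta> ^ n = 1\<close>.\<close>

lemma padic_int_adjoin_span:
  assumes root: "\<zeta> ^ n = 1" and n: "n > 0" and x: "x \<in> padic_int_adjoin \<zeta>"
  shows "\<exists>c. x = (\<Sum>i<n. padic_int_to_ac (c i) * \<zeta> ^ i)"
proof -
  obtain f where "x = poly (map_poly padic_int_to_ac f) \<zeta>"
    using x by (auto simp: padic_int_adjoin_def)
  then show ?thesis
  proof (induction f arbitrary: x)
    case 0
    then show ?case by (intro exI[of _ "\<lambda>_. 0"]) simp
  next
    case (pCons a f)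
    obtain c where c: "poly (map_poly padic_int_to_ac f) \<zeta>
        = (\<Sum>i<n. padic_int_to_ac (c i) * \<zeta> ^ i)"
      using pCons.IH by blast
    obtain m where m: "n = Suc m" using n by (cases n) auto
    define c' where "c' = (\<lambda>i. case i of 0 \<Rightarrow> a + c m | Suc j \<Rightarrow> c j)"
    have "x = padic_int_to_ac a + \<zeta> * (\<Sum>i<n. padic_int_to_ac (c i) * \<zeta> ^ i)"
      unfolding pCons.prems c[symmetric] by (simp add: map_poly_pCons)
    also have "\<zeta> * (\<Sum>i<n. padic_int_to_ac (c i) * \<zeta> ^ i)
        = (\<Sum>i<m. padic_int_to_ac (c i) * \<zeta> ^ Suc i) + padic_int_to_ac (c m) * \<zeta> ^ n"
      unfolding m by (simp add: distrib_left sum_distrib_left mult_ac)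
    finally have "x = (\<Sum>i<n. padic_int_to_ac (c' i) * \<zeta> ^ i)"
      unfolding root unfolding m sum.lessThan_Suc_shift by (simp add: c'_def)
    then show ?case by blast
  qed
qed

text \<open>Nakayama's lemma for the finitely generated \<open>\<int>\<^sub>p\<close>-module \<open>\<int>\<^sub>p[\<zeta>]\<close>: modulo the ideal
  generated by \<open>1 + p s\<close> the generators \<open>\<zeta>\<^sup>i\<close> can be eliminated one after the other.\<close>

lemma padic_int_adjoin_one_plus_p_invertible:
  fixes \<zeta> :: "'p :: prime_card padic alg_closure"
  assumes root: "\<zeta> ^ n = 1" and n: "n > 0" and s: "s \<in> padic_int_adjoin \<zeta>"
  shows "\<exists>d\<in>padic_int_adjoin \<zeta>. (1 + of_nat CARD('p) * s) * d = 1"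
proof -
  let ?R = "padic_int_adjoin \<zeta>" and ?q = "of_nat CARD('p) :: 'p padic alg_closure"
  define w where "w = 1 + ?q * s"
  define span where "span = (\<lambda>k x. \<exists>r\<in>?R. \<exists>c. x = w * r + (\<Sum>i<k. padic_int_to_ac (c i) * \<zeta> ^ i))"
  have "\<forall>x\<in>?R. span (n - k) x" if "k \<le> n" for k
    using that
  proof (induction k)
    case 0
    show ?case
    proof
      fix x assume "x \<in> ?R"
      then obtain c where "x = (\<Sum>i<n. padic_int_to_ac (c i) * \<zeta> ^ i)"
        using padic_int_adjoin_span[OF root n] by blast
      then show "span (n - 0) x"
        unfolding span_def using padic_int_adjoin_const[of 0 \<zeta>]
        by (intro bexI[of _ 0] exI[of _ c]) auto
    qed
  next
    case (Suc k)
    define m where "m = n - Suc k"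
    have m: "n - k = Suc m" using Suc.prems by (simp add: m_def)
    have IH: "span (Suc m) x" if "x \<in> ?R" for x
      using Suc that by (simp add: m)
    have zm: "\<zeta> ^ m \<in> ?R" by (intro padic_int_adjoin_power padic_int_adjoin_root)
    \<comment> \<open>Replacing \<open>p * s\<close> by \<open>w - 1\<close> in the expression for
      \<open>s * \<zeta> ^ m\<close> gives \<open>\<zeta> ^ m\<close> the coefficient
      \<open>1 + p * c m\<close>, a unit of \<open>\<int>\<^sub>p\<close>; so
      \<open>\<zeta> ^ m\<close> can be eliminated.\<close>
    from IH[OF padic_int_adjoin_mult[OF s zm]] obtain r c where r: "r \<in> ?R" and
      rc: "s * \<zeta> ^ m = w * r + (\<Sum>i<Suc m. padic_int_to_ac (c i) * \<zeta> ^ i)"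
      unfolding span_def by blast
    define \<sigma> where "\<sigma> = (\<Sum>i<m. padic_int_to_ac (c i) * \<zeta> ^ i)"
    obtain u where "(1 + of_nat CARD('p) * c m) * u = 1"
      using padic_int_one_plus_p_invertible by blast
    then have "padic_int_to_ac ((1 + of_nat CARD('p) * c m) * u) = padic_int_to_ac 1"
      by (rule arg_cong)
    then have u: "(1 + ?q * padic_int_to_ac (c m)) * padic_int_to_ac u = 1" by simp
    have "s * \<zeta> ^ m = w * r + (\<sigma> + padic_int_to_ac (c m) * \<zeta> ^ m)"
      using rc by (simp add: \<sigma>_def)
    then have wr: "w * r = s * \<zeta> ^ m - (\<sigma> + padic_int_to_ac (c m) * \<zeta> ^ m)" by simp
    have "w * (\<zeta> ^ m - ?q * r) - ?q * \<sigma> = w * \<zeta> ^ m - ?q * (w * r) - ?q * \<sigma>"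
      by (simp add: algebra_simps)
    also have "\<dots> = (1 + ?q * padic_int_to_ac (c m)) * \<zeta> ^ m"
      unfolding wr unfolding w_def by (simp add: algebra_simps)
    finally have "\<zeta> ^ m = padic_int_to_ac u * (w * (\<zeta> ^ m - ?q * r) - ?q * \<sigma>)"
      using u by (simp add: mult.assoc[symmetric] mult.commute)
    then have zeta_m: "\<zeta> ^ m = w * (padic_int_to_ac u * (\<zeta> ^ m - ?q * r))
        + (\<Sum>i<m. padic_int_to_ac (- (u * of_nat CARD('p) * c i)) * \<zeta> ^ i)"
      by (simp add: \<sigma>_def sum_distrib_left sum_negf algebra_simps)
    show ?case
    proof
      fix x assume "x \<in> ?R"
      from IH[OF this] obtain t e where t: "t \<in> ?R" and
        x: "x = w * t + (\<Sum>i<Suc m. padic_int_to_ac (e i) * \<zeta> ^ i)"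
        unfolding span_def by blast
      define t' where "t' = t + padic_int_to_ac (e m) * (padic_int_to_ac u * (\<zeta> ^ m - ?q * r))"
      have "t' \<in> ?R"
        unfolding t'_def using t r zm padic_int_adjoin_const[of "of_nat CARD('p)" \<zeta>]
        by (intro padic_int_adjoin_add padic_int_adjoin_mult padic_int_adjoin_diff
              padic_int_adjoin_const) auto
      moreover have "x = w * t' + (\<Sum>i<m. padic_int_to_ac
          (e i + e m * - (u * of_nat CARD('p) * c i)) * \<zeta> ^ i)"
      proof -
        have "x = w * t + ((\<Sum>i<m. padic_int_to_ac (e i) * \<zeta> ^ i) + padic_int_to_ac (e m) * \<zeta> ^ m)"
          unfolding x by simp
        also have "padic_int_to_ac (e m) * \<zeta> ^ m = padic_int_to_ac (e m) *
            (w * (padic_int_to_ac u * (\<zeta> ^ m - ?q * r))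
            + (\<Sum>i<m. padic_int_to_ac (- (u * of_nat CARD('p) * c i)) * \<zeta> ^ i))"
          by (subst zeta_m) (rule refl)
        finally show ?thesis
          unfolding t'_def
          by (simp add: sum_distrib_left sum.distrib sum_negf sum_subtractf algebra_simps)
      qed
      ultimately show "span (n - Suc k) x"
        unfolding span_def m_def[symmetric]
        by (intro bexI[of _ t'] exI[of _ "\<lambda>i. e i + e m * - (u * of_nat CARD('p) * c i)"])
    qed
  qed
  \<comment> \<open>After \<open>n\<close> eliminations no generator is left, so 1 itself is a
    multiple of \<open>w\<close>.\<close>
  from this[of n] have "span 0 1"
    using padic_int_adjoin_const[of 1 \<zeta>] by simp
  then show ?thesis unfolding span_def w_def[symmetric] by auto
qed

lemma padic_int_adjoin_p_subring_root:
  fixes \<zeta> :: "'p :: prime_card padic alg_closure"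
  assumes "primitive_root_of_unity CARD('p) \<zeta>"
  shows "p_subring_root (padic_int_adjoin \<zeta>) CARD('p) \<zeta>"
proof
  have pr: "\<zeta> ^ CARD('p) = 1" "CARD('p) > 0" "\<And>k. 0 < k \<Longrightarrow> k < CARD('p) \<Longrightarrow> \<zeta> ^ k \<noteq> 1"
    using assms by (auto simp: primitive_root_of_unity_def)
  have p1: "CARD('p) > 1" using prime_gt_1_nat[OF prime_card[where 'a='p]] .
  show "\<zeta> ^ CARD('p) = 1" by (rule pr)
  show "\<zeta> \<noteq> 1" using pr(3)[of 1] p1 by simp
  show "prime CARD('p)" by (rule prime_card)
  show "1 \<in> padic_int_adjoin \<zeta>" using padic_int_adjoin_const[of 1 \<zeta>] by simp
  show "\<exists>d\<in>padic_int_adjoin \<zeta>. (1 + of_nat CARD('p) * c) * d = 1"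
    if "c \<in> padic_int_adjoin \<zeta>" for c
    using pr(1,2) that by (rule padic_int_adjoin_one_plus_p_invertible)
qed (auto intro: padic_int_adjoin_diff padic_int_adjoin_mult padic_int_adjoin_root)

section \<open>Transfer to the p-adic setting\<close>

theorem theorem2p1:
  fixes p :: nat
    and \<zeta> \<pi> :: "'p :: prime_card padic alg_closure"
  assumes p: "p = CARD('p)"
    and \<zeta>: "primitive_root_of_unity p \<zeta>"
    and \<pi>: "\<pi> = - (\<Sum>k=1..p-1. (1 - \<zeta>) ^ k / of_nat k)"
  shows "\<pi> \<in> padic_int_adjoin \<zeta>
    \<and> (padic_cong \<zeta> (\<pi> ^ (p - 1)) (- of_nat p) (of_nat p ^ 2)
       \<and> padic_cong \<zeta> (\<pi> ^ (p - 1) / of_nat p) (- 1) (of_nat p))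
    \<and> (\<forall>(a :: int) (n :: nat).
         (\<forall>m :: nat. int m mod int p = (- int n) mod int p \<longrightarrow>
            padic_cong \<zeta>
              ((\<zeta> powi a - 1) ^ n)
              (\<Sum>j=0..p-2. of_rat (bernoulli_order m j) * (of_int a * \<pi>) ^ (n + j) / fact j)
              (of_nat p * \<pi> ^ n))
       \<and> (\<forall>b :: nat. b > 0 \<longrightarrow>
            padic_cong \<zeta>
              ((\<zeta> powi a - 1) ^ (p ^ b * n))
              ((of_int a * \<pi>) ^ (p ^ b * n)
                + of_nat (p ^ b * n)
                  * (\<Sum>k\<in>{1<..<p-1}. of_rat (bernoulli k) / (fact k * of_nat k)
                       * (of_int a * \<pi>) ^ (p ^ b * n + k)))
              (of_nat p ^ (b + 1) * \<pi> ^ (p ^ b * n))))"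
proof -
  interpret p_subring_root "padic_int_adjoin \<zeta>" p \<zeta>
    using padic_int_adjoin_p_subring_root \<zeta> unfolding p by blast
  have PI: "PI = \<pi>"
  proof -
    have "of_rat (fps_ln 1 $ k) * T ^ k = - ((1 - \<zeta>) ^ k / of_nat k)" if "k \<ge> 1" for k
    proof -
      have "T ^ k = (- 1) ^ k * (1 - \<zeta>) ^ k"
        by (simp add: T_def flip: power_mult_distrib)
      moreover have "(- 1) ^ k = - ((- 1) ^ (k - 1) :: 'p padic alg_closure)"
        using that by (cases k) auto
      ultimately show ?thesis
        using that by (simp add: fps_ln_nth of_rat_divide of_rat_power of_rat_minus
            flip: power_mult_distrib)
    qed
    then have "(\<Sum>k=1..p-1. of_rat (fps_ln 1 $ k) * T ^ k) = \<pi>"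
      unfolding \<pi> sum_negf[symmetric] by (intro sum.cong) auto
    moreover have "{..<p} = insert 0 {1..p-1}" using p_gt_1 by auto
    ultimately show ?thesis by (simp add: PI_def trunc_eval_def)
  qed
  have cong: "padic_cong \<zeta> x y z" if "congr z x y" "z \<noteq> 0" for x y z
    using that by (auto simp: padic_cong_def elim!: congrE)
  \<comment> \<open>Both forms of (i) express the integrality of the same quotient.\<close>
  have "(\<pi> ^ (p - 1) / of_nat p - - 1) / of_nat p = (\<pi> ^ (p - 1) - - of_nat p) / of_nat p ^ 2"
    using p_nz by (simp add: add_divide_distrib power2_eq_square)
  moreover have i: "padic_cong \<zeta> (\<pi> ^ (p - 1)) (- of_nat p) (of_nat p ^ 2)"
    using PI_power_pred p_gt_1 by (intro cong) (auto simp: PI)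
  ultimately have "padic_cong \<zeta> (\<pi> ^ (p - 1) / of_nat p) (- 1) (of_nat p)"
    by (simp only: padic_cong_def p_nz) auto
  note ii = this
  have nz: "of_nat p * \<pi> ^ k \<noteq> 0" "of_nat p ^ l * \<pi> ^ k \<noteq> 0" for k l
    using PI_nz p_gt_1 by (auto simp: PI)
  show ?thesis
    by (intro conjI allI impI PI_mem[unfolded PI] i ii
        cong[OF zeta_powi_power_bernoulli[unfolded PI] nz(1)]
        cong[OF zeta_powi_power_p_power[unfolded PI] nz(2)])
qed

end
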